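(* Let $\Phi$ be a sentence of $L_{\omega_1,\omega}$ in a countable language $L(\Phi)$, and suppose $\Phi$ has a Skolemized representation $(L,T',\Delta(w))$. If for every $\alpha<\omega_1$ there is a model $M_\alpha$ of $T'$ that omits $\Delta(w)$ and has ${\rm sprk}(M_\alpha)\ge\alpha$, then there is a model $N$ of $T'$ of cardinality $2^{\aleph_0}$ that omits $\Delta(w)$ and has an asymptotically similar subset $\{c_\eta:\eta\in 2^\omega\}$.
   Context: A representation of $\Phi$ is a triple $(L,T',\Delta(w))$ where $L\supseteq L(\Phi)$ is a countable language, $T'$ is a first-order $L$-theory and $\Delta(w)$ is a partial 1-type, such that the models of $\Phi$ are exactly the $L(\Phi)$-reducts of models of $T'$ that omit $\Delta$. It is Skolemized if $T'$ has definable Skolem functions, admits elimination of quantifiers, and has a pairing function. Splitting rank: for an $L$-structure $M$ and non-empty finite $B=\{b_0,\dots,b_{n-1}\}\subseteq M$: ${\rm sprk}(B,M)\ge 0$ iff $B\cap{\rm acl}_M(\emptyset)=\emptyset$; ${\rm sprk}(B,M)\ge\alpha+1$ iff for every $j<n$ and every quantifier-free $L$-formula $\varphi(w_0,\dots,w_{n-1})$ there is $b_j^*\in M\setminus B$ with $M\models\varphi(b_0,\dots,b_j,\dots,b_{n-1})\leftrightarrow\varphi(b_0,\dots,b_j^*,\dots,b_{n-1})$ and ${\rm sprk}(B\cup\{b_j^*\},M)\ge\alpha$; for limit $\alpha>0$, ${\rm sprk}(B,M)\ge\alpha$ iff ${\rm sprk}(B,M)\ge\beta$ for all $\beta<\alpha$.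 Then ${\rm sprk}(M)=\sup\{{\rm sprk}(B,M)+1: B\text{ a finite subset of }M\}$ if this exists, and $\infty$ otherwise. (${\rm acl}_M(\emptyset)$ is the set of elements lying in some finite set defined without parameters.) Asymptotic similarity: $k$-tuples $(\eta_0,\dots,\eta_{k-1})$, $(\tau_0,\dots,\tau_{k-1})$ of distinct elements of $2^\omega$ are similar mod $\ell$ if $\eta_0|\ell,\dots,\eta_{k-1}|\ell$ are distinct and $\eta_j|\ell=\tau_j|\ell$ for all $j$. A subset $\{c_\eta:\eta\in 2^\omega\}$ of $N$ is asymptotically similar if for every $L$-formula $\theta$ in $k$ variables there is $N_\theta$ such that for every $\ell\ge N_\theta$ and all $k$-tuples $\bar\eta,\bar\tau$ similar mod $\ell$, $N\models\theta(c_{\eta_0},\dots,c_{\eta_{k-1}})\leftrightarrow\theta(c_{\tau_0},\dots,c_{\tau_{k-1}})$. *)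

theory Defs
  imports "HOL-Library.Extended" "HOL-Library.Equipollence"
begin

section \<open>Ordinals\<close>

text \<open>The type \<open>'a ordinal\<close> consists of the isomorphism types of well-orders on subsets of \<open>'a\<close>.
  If \<open>'a\<close> is infinite of cardinality \<open>\<kappa>\<close>, these are the ordinals below the cardinal
  successor of \<open>\<kappa>\<close>.\<close>

quotient_type 'a ordinal = "'a rel" / partial: "\<lambda>r s. (r, s) \<in> ordIso"
proof (rule part_equivpI)
  have "({}, {}) \<in> (ordIso :: ('a rel \<times> 'a rel) set)"
    by (simp add: ordIso_reflexive)
  then show "\<exists>r::'a rel. (r, r) \<in> ordIso" by blast
qed (auto intro!: sympI transpI intro: ordIso_symmetric ordIso_transitive)

lemma ordIso_self_Well_order: "(r, r) \<in> ordIso \<Longrightarrow> Well_order r"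
  by (simp add: ordIso_def)

instantiation ordinal :: (type) "{zero, linorder}"
begin

lift_definition zero_ordinal :: "'a ordinal" is "{}"
  by (simp add: ordIso_reflexive)

lift_definition less_eq_ordinal :: "'a ordinal \<Rightarrow> 'a ordinal \<Rightarrow> bool"
  is "\<lambda>r s. (r, s) \<in> ordLeq"
  by (meson ordIso_ordLeq_trans ordIso_symmetric ordLeq_ordIso_trans)

lift_definition less_ordinal :: "'a ordinal \<Rightarrow> 'a ordinal \<Rightarrow> bool"
  is "\<lambda>r s. (r, s) \<in> ordLess"
  by (meson ordIso_ordLess_trans ordIso_symmetric ordLess_ordIso_trans)

instance
proof
  fix x y z :: "'a ordinal"
  show "(x < y) = (x \<le> y \<and> \<not> y \<le> x)"
    by transfer (metis not_ordLess_ordLeq ordIso_self_Well_order ordLess_imp_ordLeq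
        ordLess_or_ordLeq)
  show "x \<le> x"
    by transfer (metis ordIso_self_Well_order ordLeq_reflexive)
  show "x \<le> y \<Longrightarrow> y \<le> z \<Longrightarrow> x \<le> z"
    by transfer (rule ordLeq_transitive)
  show "x \<le> y \<Longrightarrow> y \<le> x \<Longrightarrow> x = y"
    by transfer (simp add: ordIso_iff_ordLeq)
  show "x \<le> y \<or> y \<le> x"
    by transfer (metis ordIso_self_Well_order ordLeq_total)
qed

end

instance ordinal :: (type) wellorder
proof
  fix P :: "'a ordinal \<Rightarrow> bool" and a
  assume step: "\<And>x. (\<And>y. y < x \<Longrightarrow> P y) \<Longrightarrow> P x"
  have "wf {(x, y :: 'a ordinal). x < y}"
  proof (rule wf_subset)
    show "wf (inv_image (ordLess :: ('a rel \<times> 'a rel) set) rep_ordinal)"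
      by (simp add: wf_inv_image wf_ordLess)
    show "{(x, y :: 'a ordinal). x < y} \<subseteq> inv_image ordLess rep_ordinal"
      by (auto simp: less_ordinal.rep_eq)
  qed
  then show "P a"
    by (rule wf_induct_rule) (use step in auto)
qed

definition osucc :: "'a ordinal \<Rightarrow> 'a ordinal" where
  "osucc \<alpha> = (LEAST \<beta>. \<alpha> < \<beta>)"

definition limit_ordinal :: "'a ordinal \<Rightarrow> bool" where
  "limit_ordinal \<alpha> \<longleftrightarrow> \<alpha> \<noteq> 0 \<and> (\<forall>\<beta><\<alpha>. osucc \<beta> < \<alpha>)"


section \<open>Languages, formulas and structures\<close>

text \<open>A symbol is a name together with its arity; constants are functions of arity 0.\<close>

record ('f, 'r) lang =
  Funs :: "('f \<times> nat) set"
  Rels :: "('r \<times> nat) set"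

definition countable_lang :: "('f, 'r) lang \<Rightarrow> bool" where
  "countable_lang L \<longleftrightarrow> countable (Funs L) \<and> countable (Rels L)"

definition sublang :: "('f, 'r) lang \<Rightarrow> ('f, 'r) lang \<Rightarrow> bool" where
  "sublang L\<^sub>0 L \<longleftrightarrow> Funs L\<^sub>0 \<subseteq> Funs L \<and> Rels L\<^sub>0 \<subseteq> Rels L"

datatype 'f trm = Var nat | Fn 'f "'f trm list"

datatype ('f, 'r) fm =
    Bot
  | Eq "'f trm" "'f trm"
  | Rel 'r "'f trm list"
  | Neg "('f, 'r) fm"
  | And "('f, 'r) fm" "('f, 'r) fm"
  | Ex nat "('f, 'r) fm"

text \<open>Formulas of \<open>L\<^bsub>\<omega>\<^sub>1,\<omega>\<^esub>\<close>. Subformulas of a sentence automatically have only finitely many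
  free variables.\<close>

datatype ('f, 'r) infm =
    IEq "'f trm" "'f trm"
  | IRel 'r "'f trm list"
  | INeg "('f, 'r) infm"
  | IConj "nat \<Rightarrow> ('f, 'r) infm"
  | IEx nat "('f, 'r) infm"

record ('f, 'r, 'm) struct =
  Dom :: "'m set"
  FunI :: "'f \<Rightarrow> 'm list \<Rightarrow> 'm"
  RelI :: "'r \<Rightarrow> 'm list \<Rightarrow> bool"

fun wf_trm :: "('f, 'r) lang \<Rightarrow> 'f trm \<Rightarrow> bool" where
  "wf_trm L (Var i) = True"
| "wf_trm L (Fn f ts) = ((f, length ts) \<in> Funs L \<and> (\<forall>t\<in>set ts. wf_trm L t))"

primrec wf_fm :: "('f, 'r) lang \<Rightarrow> ('f, 'r) fm \<Rightarrow> bool" where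
  "wf_fm L Bot = True"
| "wf_fm L (Eq s t) = (wf_trm L s \<and> wf_trm L t)"
| "wf_fm L (Rel r ts) = ((r, length ts) \<in> Rels L \<and> (\<forall>t\<in>set ts. wf_trm L t))"
| "wf_fm L (Neg \<phi>) = wf_fm L \<phi>"
| "wf_fm L (And \<phi> \<psi>) = (wf_fm L \<phi> \<and> wf_fm L \<psi>)"
| "wf_fm L (Ex x \<phi>) = wf_fm L \<phi>"

primrec wf_infm :: "('f, 'r) lang \<Rightarrow> ('f, 'r) infm \<Rightarrow> bool" where
  "wf_infm L (IEq s t) = (wf_trm L s \<and> wf_trm L t)"
| "wf_infm L (IRel r ts) = ((r, length ts) \<in> Rels L \<and> (\<forall>t\<in>set ts. wf_trm L t))"
| "wf_infm L (INeg \<phi>) = wf_infm L \<phi>"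
| "wf_infm L (IConj \<phi>s) = (\<forall>n. wf_infm L (\<phi>s n))"
| "wf_infm L (IEx x \<phi>) = wf_infm L \<phi>"

fun fv_trm :: "'f trm \<Rightarrow> nat set" where
  "fv_trm (Var i) = {i}"
| "fv_trm (Fn f ts) = (\<Union>t\<in>set ts. fv_trm t)"

primrec fv :: "('f, 'r) fm \<Rightarrow> nat set" where
  "fv Bot = {}"
| "fv (Eq s t) = fv_trm s \<union> fv_trm t"
| "fv (Rel r ts) = (\<Union>t\<in>set ts. fv_trm t)"
| "fv (Neg \<phi>) = fv \<phi>"
| "fv (And \<phi> \<psi>) = fv \<phi> \<union> fv \<psi>"
| "fv (Ex x \<phi>) = fv \<phi> - {x}"

primrec ifv :: "('f, 'r) infm \<Rightarrow> nat set" where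
  "ifv (IEq s t) = fv_trm s \<union> fv_trm t"
| "ifv (IRel r ts) = (\<Union>t\<in>set ts. fv_trm t)"
| "ifv (INeg \<phi>) = ifv \<phi>"
| "ifv (IConj \<phi>s) = (\<Union>n. ifv (\<phi>s n))"
| "ifv (IEx x \<phi>) = ifv \<phi> - {x}"

primrec qfree :: "('f, 'r) fm \<Rightarrow> bool" where
  "qfree Bot = True"
| "qfree (Eq s t) = True"
| "qfree (Rel r ts) = True"
| "qfree (Neg \<phi>) = qfree \<phi>"
| "qfree (And \<phi> \<psi>) = (qfree \<phi> \<and> qfree \<psi>)"
| "qfree (Ex x \<phi>) = False"

primrec eval_trm :: "('f, 'r, 'm) struct \<Rightarrow> (nat \<Rightarrow> 'm) \<Rightarrow> 'f trm \<Rightarrow> 'm" where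
  "eval_trm M v (Var i) = v i"
| "eval_trm M v (Fn f ts) = FunI M f (map (eval_trm M v) ts)"

primrec sat :: "('f, 'r, 'm) struct \<Rightarrow> (nat \<Rightarrow> 'm) \<Rightarrow> ('f, 'r) fm \<Rightarrow> bool" where
  "sat M v Bot = False"
| "sat M v (Eq s t) = (eval_trm M v s = eval_trm M v t)"
| "sat M v (Rel r ts) = RelI M r (map (eval_trm M v) ts)"
| "sat M v (Neg \<phi>) = (\<not> sat M v \<phi>)"
| "sat M v (And \<phi> \<psi>) = (sat M v \<phi> \<and> sat M v \<psi>)"
| "sat M v (Ex x \<phi>) = (\<exists>a\<in>Dom M. sat M (v(x := a)) \<phi>)"

primrec isat :: "('f, 'r, 'm) struct \<Rightarrow> ('f, 'r) infm \<Rightarrow> (nat \<Rightarrow> 'm) \<Rightarrow> bool" where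
  "isat M (IEq s t) = (\<lambda>v. eval_trm M v s = eval_trm M v t)"
| "isat M (IRel r ts) = (\<lambda>v. RelI M r (map (eval_trm M v) ts))"
| "isat M (INeg \<phi>) = (\<lambda>v. \<not> isat M \<phi> v)"
| "isat M (IConj \<phi>s) = (\<lambda>v. \<forall>n. isat M (\<phi>s n) v)"
| "isat M (IEx x \<phi>) = (\<lambda>v. \<exists>a\<in>Dom M. isat M \<phi> (v(x := a)))"

definition is_structure :: "('f, 'r) lang \<Rightarrow> ('f, 'r, 'm) struct \<Rightarrow> bool" where
  "is_structure L M \<longleftrightarrow> Dom M \<noteq> {} \<and>
     (\<forall>(f, n)\<in>Funs L. \<forall>xs. set xs \<subseteq> Dom M \<longrightarrow> length xs = n \<longrightarrow> FunI M f xs \<in> Dom M)"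

text \<open>Interpretations of symbols outside \<open>L\<^sub>0\<close> are irrelevant for an \<open>L\<^sub>0\<close>-structure, so being the
  reduct of \<open>M'\<close> means having the same domain and agreeing with \<open>M'\<close> on the symbols of \<open>L\<^sub>0\<close>.\<close>

definition is_reduct ::
  "('f, 'r) lang \<Rightarrow> ('f, 'r, 'm) struct \<Rightarrow> ('f, 'r, 'm) struct \<Rightarrow> bool" where
  "is_reduct L\<^sub>0 M M' \<longleftrightarrow> Dom M = Dom M' \<and>
     (\<forall>(f, n)\<in>Funs L\<^sub>0. \<forall>xs. set xs \<subseteq> Dom M \<longrightarrow> length xs = n \<longrightarrow> FunI M f xs = FunI M' f xs) \<and>
     (\<forall>(r, n)\<in>Rels L\<^sub>0. \<forall>xs. set xs \<subseteq> Dom M \<longrightarrow> length xs = n \<longrightarrow> RelI M r xs = RelI M' r xs)"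


section \<open>Theories, types and representations\<close>

definition is_theory :: "('f, 'r) lang \<Rightarrow> ('f, 'r) fm set \<Rightarrow> bool" where
  "is_theory L T \<longleftrightarrow> (\<forall>\<phi>\<in>T. wf_fm L \<phi> \<and> fv \<phi> = {})"

text \<open>The free variable \<open>w\<close> of a 1-type is variable 0.\<close>

definition is_partial_1type :: "('f, 'r) lang \<Rightarrow> ('f, 'r) fm set \<Rightarrow> bool" where
  "is_partial_1type L \<Delta> \<longleftrightarrow> (\<forall>\<delta>\<in>\<Delta>. wf_fm L \<delta> \<and> fv \<delta> \<subseteq> {0})"

definition is_sentence :: "('f, 'r) lang \<Rightarrow> ('f, 'r) infm \<Rightarrow> bool" where
  "is_sentence L \<Phi> \<longleftrightarrow> wf_infm L \<Phi> \<and> ifv \<Phi> = {}"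

definition models :: "('f, 'r) lang \<Rightarrow> ('f, 'r, 'm) struct \<Rightarrow> ('f, 'r) fm set \<Rightarrow> bool" where
  "models L M T \<longleftrightarrow>
     is_structure L M \<and> (\<forall>\<phi>\<in>T. \<forall>v. range v \<subseteq> Dom M \<longrightarrow> sat M v \<phi>)"

definition imodels :: "('f, 'r) lang \<Rightarrow> ('f, 'r, 'm) struct \<Rightarrow> ('f, 'r) infm \<Rightarrow> bool" where
  "imodels L M \<Phi> \<longleftrightarrow> is_structure L M \<and> (\<forall>v. range v \<subseteq> Dom M \<longrightarrow> isat M \<Phi> v)"

definition omits :: "('f, 'r, 'm) struct \<Rightarrow> ('f, 'r) fm set \<Rightarrow> bool" where
  "omits M \<Delta> \<longleftrightarrow> \<not> (\<exists>a\<in>Dom M. \<forall>\<delta>\<in>\<Delta>. sat M (\<lambda>_. a) \<delta>)"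

text \<open>The argument \<^typ>\<open>'m itself\<close> below is the universe from which structures are drawn.
  For a countable language and an infinite \<^typ>\<open>'m\<close>, consequence of a theory, and hence
  Skolemization, does not depend on it, by the Loewenheim-Skolem theorem.\<close>

definition representation ::
  "'m itself \<Rightarrow> ('f, 'r) lang \<Rightarrow> ('f, 'r) infm \<Rightarrow>
     ('f, 'r) lang \<Rightarrow> ('f, 'r) fm set \<Rightarrow> ('f, 'r) fm set \<Rightarrow> bool" where
  "representation _ L\<^sub>\<Phi> \<Phi> L T \<Delta> \<longleftrightarrow>
     sublang L\<^sub>\<Phi> L \<and> countable_lang L \<and> is_theory L T \<and> is_partial_1type L \<Delta> \<and>
     (\<forall>M :: ('f, 'r, 'm) struct.
        imodels L\<^sub>\<Phi> M \<Phi> \<longleftrightarrow>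
        (\<exists>M' :: ('f, 'r, 'm) struct. models L M' T \<and> omits M' \<Delta> \<and> is_reduct L\<^sub>\<Phi> M M'))"

definition has_definable_Skolem_functions ::
  "'m itself \<Rightarrow> ('f, 'r) lang \<Rightarrow> ('f, 'r) fm set \<Rightarrow> bool" where
  "has_definable_Skolem_functions _ L T \<longleftrightarrow>
     (\<forall>\<phi> y. wf_fm L \<phi> \<longrightarrow>
       (\<exists>\<psi>. wf_fm L \<psi> \<and> fv \<psi> \<subseteq> insert y (fv \<phi>) \<and>
         (\<forall>M :: ('f, 'r, 'm) struct. models L M T \<longrightarrow>
           (\<forall>v. range v \<subseteq> Dom M \<longrightarrow>
             (\<exists>!b. b \<in> Dom M \<and> sat M (v(y := b)) \<psi>) \<and>
             (sat M v (Ex y \<phi>) \<longrightarrow>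
               (\<forall>b\<in>Dom M. sat M (v(y := b)) \<psi> \<longrightarrow> sat M (v(y := b)) \<phi>))))))"

definition has_quantifier_elimination ::
  "'m itself \<Rightarrow> ('f, 'r) lang \<Rightarrow> ('f, 'r) fm set \<Rightarrow> bool" where
  "has_quantifier_elimination _ L T \<longleftrightarrow>
     (\<forall>\<phi>. wf_fm L \<phi> \<longrightarrow>
       (\<exists>\<psi>. wf_fm L \<psi> \<and> qfree \<psi> \<and> fv \<psi> \<subseteq> fv \<phi> \<and>
         (\<forall>M :: ('f, 'r, 'm) struct. models L M T \<longrightarrow>
           (\<forall>v. range v \<subseteq> Dom M \<longrightarrow> (sat M v \<phi> \<longleftrightarrow> sat M v \<psi>)))))"

definition has_pairing_function ::
  "'m itself \<Rightarrow> ('f, 'r) lang \<Rightarrow> ('f, 'r) fm set \<Rightarrow> bool" where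
  "has_pairing_function _ L T \<longleftrightarrow>
     (\<exists>\<pi>. wf_fm L \<pi> \<and> fv \<pi> \<subseteq> {0, 1, 2} \<and>
       (\<forall>M :: ('f, 'r, 'm) struct. models L M T \<longrightarrow>
         (\<exists>p. p ` (Dom M \<times> Dom M) \<subseteq> Dom M \<and> inj_on p (Dom M \<times> Dom M) \<and>
           (\<forall>a\<in>Dom M. \<forall>b\<in>Dom M. \<forall>c\<in>Dom M.
             sat M ((!) [a, b, c]) \<pi> \<longleftrightarrow> p (a, b) = c))))"

definition Skolemized_representation ::
  "'m itself \<Rightarrow> ('f, 'r) lang \<Rightarrow> ('f, 'r) infm \<Rightarrow>
     ('f, 'r) lang \<Rightarrow> ('f, 'r) fm set \<Rightarrow> ('f, 'r) fm set \<Rightarrow> bool" where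
  "Skolemized_representation U L\<^sub>\<Phi> \<Phi> L T \<Delta> \<longleftrightarrow>
     representation U L\<^sub>\<Phi> \<Phi> L T \<Delta> \<and>
     has_definable_Skolem_functions U L T \<and>
     has_quantifier_elimination U L T \<and>
     has_pairing_function U L T"


section \<open>Splitting rank\<close>

definition acl_empty :: "('f, 'r) lang \<Rightarrow> ('f, 'r, 'm) struct \<Rightarrow> 'm set" where
  "acl_empty L M = {a. \<exists>\<phi>. wf_fm L \<phi> \<and> fv \<phi> \<subseteq> {0} \<and>
     finite {b\<in>Dom M. sat M (\<lambda>_. b) \<phi>} \<and> a \<in> {b\<in>Dom M. sat M (\<lambda>_. b) \<phi>}}"

definition finite_nonempty_subset :: "'m set \<Rightarrow> ('f, 'r, 'm) struct \<Rightarrow> bool" where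
  "finite_nonempty_subset B M \<longleftrightarrow> finite B \<and> B \<noteq> {} \<and> B \<subseteq> Dom M"

text \<open>\<open>sprk_ge L M B \<alpha>\<close> says that the splitting rank of \<open>B\<close> in \<open>M\<close> is at least \<open>\<alpha>\<close>. On an
  infinite type the conclusions of the three rules are mutually exclusive, so each rule is an
  equivalence. The list \<open>bs\<close> ranges over the enumerations of \<open>B\<close>; which one is used does not matter
  because variables can be permuted.\<close>

inductive sprk_ge ::
  "('f, 'r) lang \<Rightarrow> ('f, 'r, 'm) struct \<Rightarrow> 'm set \<Rightarrow> 'm ordinal \<Rightarrow> bool"
  for L :: "('f, 'r) lang" and M :: "('f, 'r, 'm) struct" where
  zero: "\<lbrakk>finite_nonempty_subset B M; B \<inter> acl_empty L M = {}\<rbrakk> \<Longrightarrow> sprk_ge L M B 0"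
| succ: "\<lbrakk>finite_nonempty_subset B M;
    \<And>bs j \<phi>. \<lbrakk>distinct bs; set bs = B; j < length bs;
        wf_fm L \<phi>; qfree \<phi>; fv \<phi> \<subseteq> {..<length bs}\<rbrakk> \<Longrightarrow>
      \<exists>b'\<in>Dom M - B.
        (sat M ((!) bs) \<phi> \<longleftrightarrow> sat M ((!) (bs[j := b'])) \<phi>) \<and> sprk_ge L M (B \<union> {b'}) \<alpha>\<rbrakk>
    \<Longrightarrow> sprk_ge L M B (osucc \<alpha>)"
| limit: "\<lbrakk>finite_nonempty_subset B M; limit_ordinal \<alpha>; \<And>\<beta>. \<beta> < \<alpha> \<Longrightarrow> sprk_ge L M B \<beta>\<rbrakk>
    \<Longrightarrow> sprk_ge L M B \<alpha>"

text \<open>For infinite \<^typ>\<open>'m\<close>, ordinals in \<^typ>\<open>'m ordinal\<close> suffice: ranks of finite sets other than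
  \<open>\<infinity>\<close> form an initial segment of the ordinals and \<^typ>\<open>'m\<close> has only \<open>|'m|\<close> finite subsets.
  Finite sets meeting the algebraic closure of the empty set get rank \<^const>\<open>Minf\<close>.\<close>

definition sprk_set ::
  "('f, 'r) lang \<Rightarrow> ('f, 'r, 'm) struct \<Rightarrow> 'm set \<Rightarrow> 'm ordinal extended" where
  "sprk_set L M B =
     (if \<not> sprk_ge L M B 0 then Minf
      else if \<forall>\<alpha>. sprk_ge L M B \<alpha> then Pinf
      else Fin (GREATEST \<alpha>. sprk_ge L M B \<alpha>))"

fun esucc :: "'a ordinal extended \<Rightarrow> 'a ordinal extended" where
  "esucc Minf = Minf"
| "esucc (Fin \<alpha>) = Fin (osucc \<alpha>)"
| "esucc Pinf = Pinf"

definition sprk :: "('f, 'r) lang \<Rightarrow> ('f, 'r, 'm) struct \<Rightarrow> 'm ordinal extended" where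
  "sprk L M =
     (let bound = (\<lambda>\<gamma>. \<forall>B. finite_nonempty_subset B M \<longrightarrow> esucc (sprk_set L M B) \<le> Fin \<gamma>)
      in if \<exists>\<gamma>. bound \<gamma> then Fin (LEAST \<gamma>. bound \<gamma>) else Pinf)"


section \<open>Asymptotic similarity\<close>

definition restr :: "(nat \<Rightarrow> bool) \<Rightarrow> nat \<Rightarrow> bool list" where
  "restr \<eta> l = map \<eta> [0..<l]"

definition similar_mod :: "nat \<Rightarrow> (nat \<Rightarrow> bool) list \<Rightarrow> (nat \<Rightarrow> bool) list \<Rightarrow> bool" where
  "similar_mod l \<eta>s \<tau>s \<longleftrightarrow>
     distinct \<eta>s \<and> distinct \<tau>s \<and> length \<eta>s = length \<tau>s \<and>
     distinct (map (\<lambda>\<eta>. restr \<eta> l) \<eta>s) \<and>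
     (\<forall>j<length \<eta>s. restr (\<eta>s ! j) l = restr (\<tau>s ! j) l)"

text \<open>The elements \<open>c \<eta>\<close> are required to be distinct: a constant family would satisfy the condition
  on formulas trivially.\<close>

definition asymptotically_similar ::
  "('f, 'r) lang \<Rightarrow> ('f, 'r, 'm) struct \<Rightarrow> ((nat \<Rightarrow> bool) \<Rightarrow> 'm) \<Rightarrow> bool" where
  "asymptotically_similar L N c \<longleftrightarrow>
     range c \<subseteq> Dom N \<and> inj c \<and>
     (\<forall>k \<theta>. wf_fm L \<theta> \<and> fv \<theta> \<subseteq> {..<k} \<longrightarrow>
       (\<exists>n. \<forall>l\<ge>n. \<forall>\<eta>s \<tau>s. length \<eta>s = k \<and> length \<tau>s = k \<and> similar_mod l \<eta>s \<tau>s \<longrightarrow>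
         (sat N ((!) (map c \<eta>s)) \<theta> \<longleftrightarrow> sat N ((!) (map c \<tau>s)) \<theta>)))"

end

theory Submission
  imports Defs
begin

text \<open>Call a formula in \<open>n\<close> variables realized if for every countable ordinal \<open>\<alpha>\<close> it holds of an
  \<open>n\<close>-tuple of rank at least \<open>\<alpha>\<close> in a model of \<open>T'\<close> omitting \<open>\<Delta>\<close>. A tuple of rank above \<open>\<alpha>\<close>
  can be extended by a copy of any of its entries, preserving a given formula and rank \<open>\<alpha>\<close>. If
  countably many formulas cover all tuples, then by regularity of \<open>\<omega>\<^sub>1\<close> one of them can be added to
  a realized formula. Alternating the two steps gives models \<open>M l\<close> with elements indexed by the
  binary strings of length \<open>l\<close> such that every formula has an eventually constant truth value along any
  branches, and the values of any definable function of branches eventually refute a fixed formula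
  of \<open>\<Delta>\<close>. The model \<open>N\<close> consists of the definable functions of branches
  modulo eventual equality in \<open>l\<close>. The proof of Los's theorem for it needs neither an ultrafilter
  nor compactness: eventual constancy handles negation, and Skolem functions handle quantifiers.\<close>


section \<open>Countable ordinals\<close>

text \<open>The obstacle is that tuples of rank at least \<alpha> live in models that vary with
  \<alpha>, so no tuple and no complete type can be carried from stage to stage. What survives is
  one formula realized at every countable rank. A newly split element copies its parent only with
  respect to the formula reached so far, and formulas decided later may separate the two; this is
  why similarity holds only modulo large \<open>l\<close>. Coherence between the \<open>M l\<close>
  comes only from entailments between the chosen formulas: an arbitrary realization of each is good
  enough. Omitting \<Delta> is not a first-order condition on a tuple. For each formula \<psi> it is
  replaced by a covering: either \<psi> has no solution, or some solution refutes a particular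
  \<delta> in \<Delta>. There may be infinitely many \<delta>, hence the appeal to suprema of
  countable ordinals where a finite pigeonhole would not do. Quantifier elimination enters because
  splitting preserves quantifier-free formulas only.\<close>

lemma zero_ordinal_le: "0 \<le> (\<alpha> :: 'a ordinal)"
proof transfer
  fix r :: "'a rel"
  assume "(r, r) \<in> ordIso"
  then have "Well_order r"
    by (rule ordIso_self_Well_order)
  then show "({} :: 'a rel, r) \<in> ordLeq"
    using ofilter_subset_ordLeq[of r "{}" "Field r"] wo_rel.Field_ofilter[of r]
    by (simp add: wo_rel.ofilter_def wo_rel_def Restr_Field)
qed

text \<open>Over a finite type there is a largest ordinal, where the \<open>LEAST\<close> in
  \<open>osucc\<close> is unspecified; the premise that something lies above \<alpha> excludes this
  case.\<close>

lemma less_osucc: "\<alpha> < \<beta> \<Longrightarrow> \<alpha> < osucc \<alpha>"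
  unfolding osucc_def by (rule LeastI)

lemma osucc_le: "\<alpha> < \<beta> \<Longrightarrow> osucc \<alpha> \<le> \<beta>"
  unfolding osucc_def by (rule Least_le)

lemma less_osuccD: "\<beta> < osucc \<alpha> \<Longrightarrow> \<beta> \<le> \<alpha>"
  unfolding osucc_def using not_less_Least leI by blast

lemma ordinal_cases [case_names zero succ limit]:
  fixes \<alpha> :: "'a ordinal"
  obtains "\<alpha> = 0" | \<beta> where "\<beta> < \<alpha>" "\<alpha> = osucc \<beta>" | "limit_ordinal \<alpha>"
  unfolding limit_ordinal_def by (metis less_osucc osucc_le order.not_eq_order_implies_strict)

text \<open>A well-order of the whole type sends each point to the order type of its strict initial
  segment, and distinct points get distinct types.\<close>

lemma uncountable_ordinal:
  assumes "uncountable (UNIV :: 'a set)"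
  shows "uncountable (UNIV :: 'a ordinal set)"
proof -
  let ?r = "card_of (UNIV :: 'a set)"
  have wo: "Well_order ?r" and F: "Field ?r = UNIV"
    by (rule card_of_Well_order, rule Field_card_of)
  interpret W: wo_rel ?r
    using wo by (simp add: wo_rel_def)
  let ?s = "\<lambda>a. Restr ?r (underS ?r a)"
  let ?t = "\<lambda>a. abs_ordinal (?s a)"
  have self: "(?s a, ?s a) \<in> ordIso" for a
    using wo by (intro ordIso_reflexive Well_order_Restr)
  have less: "(?s a, ?s b) \<in> ordLess" if "a \<in> underS ?r b" for a b
  proof -
    have "underS ?r a \<subset> underS ?r b"
      using that W.TRANS W.ANTISYM by (auto simp: underS_def trans_def antisym_def)
    then show ?thesis
      using ofilter_subset_ordLess[OF wo W.underS_ofilter W.underS_ofilter] by blast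
  qed
  have lt: "?t a < ?t b" if "a \<in> underS ?r b" for a b
    using less[OF that] self by (simp add: less_ordinal.abs_eq)
  have "inj ?t"
  proof (rule injI)
    fix a b assume "?t a = ?t b"
    then show "a = b"
      using lt[of a b] lt[of b a] W.TOTAL F
      by (auto simp: underS_def total_on_def)
  qed
  then show ?thesis
    using assms countable_image_inj_on[OF countable_subset[OF subset_UNIV]] by blast
qed

text \<open>A countable union of countable initial segments is countable and so misses some ordinal.
  The least missed ordinal is the bound: its predecessors all lie in the union. Countability of
  \<open>{..<\<alpha>}\<close> expresses that \<alpha> is below
  \<open>\<omega>\<^sub>1\<close>.\<close>

lemma countable_bound:
  fixes A :: "'a ordinal set"
  assumes "uncountable (UNIV :: 'a set)" "countable A" "\<And>\<alpha>. \<alpha> \<in> A \<Longrightarrow> countable {..<\<alpha>}"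
  obtains \<beta> where "countable {..<\<beta>}" "\<And>\<alpha>. \<alpha> \<in> A \<Longrightarrow> \<alpha> < \<beta>"
proof -
  let ?X = "\<Union>\<alpha>\<in>A. {..\<alpha>}"
  have "countable {..\<alpha>}" if "\<alpha> \<in> A" for \<alpha>
    using assms(3)[OF that] by (simp flip: ivl_disj_un_singleton(2))
  then have "countable ?X"
    using assms(2) by blast
  then obtain \<gamma> where \<gamma>: "\<gamma> \<notin> ?X"
    using uncountable_ordinal[OF assms(1)] by (metis UNIV_eq_I)
  define \<beta> where "\<beta> = (LEAST \<beta>. \<beta> \<notin> ?X)"
  have "\<beta> \<notin> ?X"
    unfolding \<beta>_def using \<gamma> by (rule LeastI)
  moreover have "{..<\<beta>} \<subseteq> ?X"
    unfolding \<beta>_def using not_less_Least by auto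
  ultimately show thesis
    using that \<open>countable ?X\<close> by (metis (no_types, lifting) UN_iff atMost_iff countable_subset not_le)
qed

lemma countable_osucc:
  fixes \<alpha> :: "'a ordinal"
  assumes "uncountable (UNIV :: 'a set)" "countable {..<\<alpha>}"
  shows "\<alpha> < osucc \<alpha>" "countable {..<osucc \<alpha>}"
proof -
  obtain \<beta> where "\<alpha> < \<beta>"
    using countable_bound[of "{\<alpha>}"] assms
    by (metis countable_empty countable_insert singletonD singletonI)
  then show "\<alpha> < osucc \<alpha>"
    by (rule less_osucc)
  have "{..<osucc \<alpha>} \<subseteq> insert \<alpha> {..<\<alpha>}"
    using less_osuccD by fastforce
  then show "countable {..<osucc \<alpha>}"
    using assms(2) by (meson countable_insert countable_subset)
qed


section \<open>Substitution of variables\<close>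

lemma eval_trm_cong: "(\<And>i. i \<in> fv_trm t \<Longrightarrow> v i = w i) \<Longrightarrow> eval_trm M v t = eval_trm M w t"
proof (induction t)
  case (Fn f ts)
  then have "map (eval_trm M v) ts = map (eval_trm M w) ts"
    by (intro map_cong) auto
  then show ?case by (metis eval_trm.simps(2))
qed simp

lemma sat_cong: "(\<And>i. i \<in> fv \<phi> \<Longrightarrow> v i = w i) \<Longrightarrow> sat M v \<phi> \<longleftrightarrow> sat M w \<phi>"
proof (induction \<phi> arbitrary: v w)
  case (Eq s t)
  have "eval_trm M v s = eval_trm M w s" "eval_trm M v t = eval_trm M w t"
    by (intro eval_trm_cong Eq.prems; simp)+
  then show ?case by simp
next
  case (Rel r ts)
  then have "map (eval_trm M v) ts = map (eval_trm M w) ts"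
    by (intro map_cong eval_trm_cong) auto
  then show ?case by (metis sat.simps(3))
next
  case (And \<phi> \<psi>)
  have "sat M v \<phi> \<longleftrightarrow> sat M w \<phi>" "sat M v \<psi> \<longleftrightarrow> sat M w \<psi>"
    by (intro And.IH And.prems; simp)+
  then show ?case by simp
next
  case (Ex x \<phi>)
  have "sat M (v(x := a)) \<phi> \<longleftrightarrow> sat M (w(x := a)) \<phi>" for a
    by (rule Ex.IH) (use Ex.prems in auto)
  then show ?case by simp
next
  case (Neg \<phi>)
  have "sat M v \<phi> \<longleftrightarrow> sat M w \<phi>"
    by (intro Neg.IH Neg.prems; simp)
  then show ?case by simp
qed auto

lemma finite_fv_trm: "finite (fv_trm t)"
  by (induction t) auto

lemma finite_fv: "finite (fv \<phi>)"
  by (induction \<phi>) (auto simp: finite_fv_trm)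

primrec ren_trm :: "(nat \<Rightarrow> nat) \<Rightarrow> 'f trm \<Rightarrow> 'f trm" where
  "ren_trm \<rho> (Var i) = Var (\<rho> i)"
| "ren_trm \<rho> (Fn f ts) = Fn f (map (ren_trm \<rho>) ts)"

text \<open>Renamings may identify variables, so the bound variable moves outside the image of the
  other free variables; no renamed variable is then captured.\<close>

primrec ren :: "(nat \<Rightarrow> nat) \<Rightarrow> ('f, 'r) fm \<Rightarrow> ('f, 'r) fm" where
  "ren \<rho> Bot = Bot"
| "ren \<rho> (Eq s t) = Eq (ren_trm \<rho> s) (ren_trm \<rho> t)"
| "ren \<rho> (Rel r ts) = Rel r (map (ren_trm \<rho>) ts)"
| "ren \<rho> (Neg \<phi>) = Neg (ren \<rho> \<phi>)"
| "ren \<rho> (And \<phi> \<psi>) = And (ren \<rho> \<phi>) (ren \<rho> \<psi>)"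
| "ren \<rho> (Ex x \<phi>) =
     (let z = (SOME z. z \<notin> \<rho> ` (fv \<phi> - {x})) in Ex z (ren (\<rho>(x := z)) \<phi>))"

lemma fresh_var: "(SOME z. z \<notin> \<rho> ` (fv \<phi> - {x})) \<notin> (\<rho> :: nat \<Rightarrow> nat) ` (fv \<phi> - {x})"
  using someI_ex[OF ex_new_if_finite[of "\<rho> ` (fv \<phi> - {x})"]] finite_fv
  by (metis finite_Diff finite_imageI infinite_UNIV_nat)

lemma wf_ren_trm: "wf_trm L (ren_trm \<rho> t) = wf_trm L t"
  by (induction t) auto

lemma wf_ren [simp]: "wf_fm L (ren \<rho> \<phi>) = wf_fm L \<phi>"
  by (induction \<phi> arbitrary: \<rho>) (auto simp: wf_ren_trm Let_def)

lemma fv_ren_trm: "fv_trm (ren_trm \<rho> t) = \<rho> ` fv_trm t"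
  by (induction t) auto

lemma fv_ren: "fv (ren \<rho> \<phi>) \<subseteq> \<rho> ` fv \<phi>"
proof (induction \<phi> arbitrary: \<rho>)
  case (Ex x \<phi>)
  define z where "z = (SOME z. z \<notin> \<rho> ` (fv \<phi> - {x}))"
  have "fv (ren (\<rho>(x := z)) \<phi>) - {z} \<subseteq> \<rho>(x := z) ` fv \<phi> - {z}"
    using Ex.IH[of "\<rho>(x := z)"] by blast
  also have "\<dots> \<subseteq> \<rho> ` (fv \<phi> - {x})"
    by (auto split: if_splits)
  finally show ?case by (simp only: ren.simps Let_def fv.simps flip: z_def)
next
  case (And \<phi> \<psi>)
  then show ?case by (simp add: image_Un le_supI1 le_supI2)
qed (auto simp: fv_ren_trm)

lemma eval_ren_trm: "eval_trm M v (ren_trm \<rho> t) = eval_trm M (v \<circ> \<rho>) t"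
proof (induction t)
  case (Fn f ts)
  then have "map (eval_trm M v \<circ> ren_trm \<rho>) ts = map (eval_trm M (v \<circ> \<rho>)) ts"
    by (intro map_cong) (auto simp: o_def)
  then show ?case by (metis eval_trm.simps(2) list.map_comp ren_trm.simps(2))
qed auto

lemma sat_ren [simp]: "sat M v (ren \<rho> \<phi>) \<longleftrightarrow> sat M (v \<circ> \<rho>) \<phi>"
proof (induction \<phi> arbitrary: v \<rho>)
  case (Rel r ts)
  have "map (eval_trm M v \<circ> ren_trm \<rho>) ts = map (eval_trm M (v \<circ> \<rho>)) ts"
    by (intro map_cong) (auto simp: eval_ren_trm)
  then show ?case by (metis list.map_comp ren.simps(3) sat.simps(3))
next
  case (Ex x \<phi>)
  define z where "z = (SOME z. z \<notin> \<rho> ` (fv \<phi> - {x}))"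
  have z: "z \<notin> \<rho> ` (fv \<phi> - {x})"
    unfolding z_def by (rule fresh_var)
  have "sat M (v(z := a) \<circ> \<rho>(x := z)) \<phi> \<longleftrightarrow> sat M ((v \<circ> \<rho>)(x := a)) \<phi>" for a
    by (rule sat_cong) (use z in auto)
  then show ?case by (simp only: ren.simps Let_def sat.simps Ex.IH flip: z_def)
qed (auto simp: eval_ren_trm)

lemma eval_trm_in_Dom:
  assumes "is_structure L M" "wf_trm L t" "range v \<subseteq> Dom M"
  shows "eval_trm M v t \<in> Dom M"
  using assms(2)
proof (induction t)
  case (Fn f ts)
  then have "set (map (eval_trm M v) ts) \<subseteq> Dom M" "length (map (eval_trm M v) ts) = length ts"
    by auto
  then show ?case
    using assms(1) Fn.prems unfolding is_structure_def by (simp only: eval_trm.simps wf_trm.simps) blast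
qed (use assms(3) in auto)

section \<open>Countability of the set of formulas\<close>

lemma countable_wf_trm:
  assumes "countable_lang L"
  shows "countable {t. wf_trm L t}"
proof -
  define F where "F = fst ` Funs L"
  have cF: "countable F"
    using assms unfolding F_def countable_lang_def by blast
  \<comment> \<open>The types of names may be uncountable, so countability is inherited from the
    language, by induction on the size of terms.\<close>
  define T where "T n = {t. wf_trm L t \<and> size t \<le> n}" for n
  have "countable (T n)" for n
  proof (induction n)
    case 0
    have "T 0 \<subseteq> range Var"
      unfolding T_def by (auto elim: wf_trm.elims)
    then show ?case by (meson countable_subset countable_image countableI_type)
  next
    case (Suc n)
    have "T (Suc n) \<subseteq> range Var \<union> (\<lambda>(f, ts). Fn f ts) ` (F \<times> lists (T n))"
    proof
      fix t assume t: "t \<in> T (Suc n)"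
      show "t \<in> range Var \<union> (\<lambda>(f, ts). Fn f ts) ` (F \<times> lists (T n))"
      proof (cases t)
        case (Fn f ts)
        have "size s \<le> n" if "s \<in> set ts" for s
          using t size_list_estimation'[OF that, of "size s" size] unfolding T_def Fn by simp
        then have "ts \<in> lists (T n)" "f \<in> F"
          using t unfolding T_def Fn F_def by (auto intro: rev_image_eqI)
        then show ?thesis unfolding Fn by (intro UnI2 image_eqI[of _ _ "(f, ts)"]) auto
      qed auto
    qed
    moreover have "countable (range (Var :: nat \<Rightarrow> 'a trm) \<union> (\<lambda>(f, ts). Fn f ts) ` (F \<times> lists (T n)))"
      using Suc cF by (intro countable_Un countable_image countable_SIGMA countable_lists) auto
    ultimately show ?case by (rule countable_subset)
  qed
  moreover have "{t. wf_trm L t} = (\<Union>n. T n)"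
    unfolding T_def by auto
  ultimately show ?thesis by simp
qed

lemma countable_wf_fm:
  assumes "countable_lang L"
  shows "countable {\<phi>. wf_fm L \<phi>}"
proof -
  define R where "R = fst ` Rels L"
  have cR: "countable R"
    using assms unfolding R_def countable_lang_def by blast
  let ?T = "{t. wf_trm L t}"
  have cT: "countable ?T" using assms by (rule countable_wf_trm)
  define W where "W n = {\<phi>. wf_fm L \<phi> \<and> size \<phi> \<le> n}" for n
  let ?S = "\<lambda>X. {Bot} \<union> (\<lambda>(s, t). Eq s t) ` (?T \<times> ?T) \<union> (\<lambda>(r, ts). Rel r ts) ` (R \<times> lists ?T)
      \<union> Neg ` X \<union> (\<lambda>(\<phi>, \<psi>). And \<phi> \<psi>) ` (X \<times> X) \<union> (\<lambda>(x, \<phi>). Ex x \<phi>) ` (UNIV \<times> X)"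
  have cS: "countable (?S X)" if "countable X" for X
    using that cT cR
    by (intro countable_Un countable_image countable_SIGMA countable_lists) auto
  have step: "\<phi> \<in> ?S X"
    if "wf_fm L \<phi>" "\<And>\<psi>. wf_fm L \<psi> \<Longrightarrow> size \<psi> < size \<phi> \<Longrightarrow> \<psi> \<in> X" for \<phi> X
    using that
  proof (cases \<phi>)
    case (Rel r ts)
    then have "(r, ts) \<in> R \<times> lists ?T"
      using that by (auto simp: R_def intro: rev_image_eqI)
    then show ?thesis unfolding Rel by blast
  qed force+
  have "countable (W n)" for n
  proof (induction n)
    case 0
    have "W 0 \<subseteq> ?S {}"
    proof
      fix \<phi> assume "\<phi> \<in> W 0"
      then show "\<phi> \<in> ?S {}" by (intro step) (auto simp: W_def)
    qed
    then show ?case using cS by (meson countable_empty countable_subset)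
  next
    case (Suc n)
    have "W (Suc n) \<subseteq> ?S (W n)"
    proof
      fix \<phi> assume "\<phi> \<in> W (Suc n)"
      then show "\<phi> \<in> ?S (W n)" by (intro step) (auto simp: W_def)
    qed
    then show ?case using Suc cS by (meson countable_subset)
  qed
  moreover have "{\<phi>. wf_fm L \<phi>} = (\<Union>n. W n)"
    unfolding W_def by auto
  ultimately show ?thesis by simp
qed


section \<open>Splitting rank\<close>

text \<open>The successor clause of the rank, with \<open>Q\<close> for having rank at least
  \<alpha>. Abstracting \<open>Q\<close> lets the clause appear in induction hypotheses and be
  weakened by monotonicity.\<close>

definition splits ::
  "('f, 'r) lang \<Rightarrow> ('f, 'r, 'm) struct \<Rightarrow> ('m set \<Rightarrow> bool) \<Rightarrow> 'm set \<Rightarrow> bool" where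
  "splits L M Q B \<longleftrightarrow> (\<forall>bs j \<phi>. distinct bs \<longrightarrow> set bs = B \<longrightarrow> j < length bs \<longrightarrow>
     wf_fm L \<phi> \<longrightarrow> qfree \<phi> \<longrightarrow> fv \<phi> \<subseteq> {..<length bs} \<longrightarrow>
     (\<exists>b'\<in>Dom M - B. (sat M ((!) bs) \<phi> \<longleftrightarrow> sat M ((!) (bs[j := b'])) \<phi>) \<and> Q (B \<union> {b'})))"

lemma splits_mono:
  assumes "splits L M Q B" "\<And>C. Q C \<Longrightarrow> Q' C"
  shows "splits L M Q' B"
  unfolding splits_def
proof (intro allI impI)
  fix bs j and \<phi> :: "('a, 'b) fm"
  assume "distinct bs" "set bs = B" "j < length bs" "wf_fm L \<phi>" "qfree \<phi>" "fv \<phi> \<subseteq> {..<length bs}"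
  from assms(1)[unfolded splits_def, rule_format, OF this]
  obtain b where "b \<in> Dom M - B" "sat M ((!) bs) \<phi> \<longleftrightarrow> sat M ((!) (bs[j := b])) \<phi>" "Q (B \<union> {b})"
    by (elim bexE conjE)
  with assms(2)[of "B \<union> {b}"]
  show "\<exists>b'\<in>Dom M - B. (sat M ((!) bs) \<phi> \<longleftrightarrow> sat M ((!) (bs[j := b'])) \<phi>) \<and> Q' (B \<union> {b'})"
    by (intro bexI[of _ b]) simp_all
qed

lemma splits_witness:
  assumes "finite_nonempty_subset B M" "splits L M Q B"
  obtains b where "b \<in> Dom M - B" "Q (B \<union> {b})"
proof -
  obtain bs where "set bs = B" "distinct bs"
    using assms(1) finite_distinct_list unfolding finite_nonempty_subset_def by blast
  moreover from this have "0 < length bs"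
    using assms(1) unfolding finite_nonempty_subset_def by auto
  ultimately show thesis
    using that assms(2)[unfolded splits_def, rule_format, of bs 0 Bot] by auto
qed

lemma sprk_ge_induct [consumes 1, case_names zero succ limit]:
  assumes "sprk_ge L M B \<alpha>"
    and "\<And>B. finite_nonempty_subset B M \<Longrightarrow> B \<inter> acl_empty L M = {} \<Longrightarrow> P B 0"
    and "\<And>B \<alpha>. finite_nonempty_subset B M \<Longrightarrow>
           splits L M (\<lambda>C. sprk_ge L M C \<alpha> \<and> P C \<alpha>) B \<Longrightarrow> P B (osucc \<alpha>)"
    and "\<And>B \<alpha>. finite_nonempty_subset B M \<Longrightarrow> limit_ordinal \<alpha> \<Longrightarrow>
           (\<And>\<beta>. \<beta> < \<alpha> \<Longrightarrow> sprk_ge L M B \<beta>) \<Longrightarrow> (\<And>\<beta>. \<beta> < \<alpha> \<Longrightarrow> P B \<beta>) \<Longrightarrow> P B \<alpha>"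
  shows "P B \<alpha>"
  using assms(1)
proof (induction rule: sprk_ge.induct)
  case (zero B)
  then show ?case by (rule assms(2))
next
  case (succ B \<alpha>)
  show ?case
    by (rule assms(3), fact succ(1), unfold splits_def) (use succ(2) in blast)
next
  case (limit B \<alpha>)
  show ?case by (rule assms(4)) (use limit in blast)+
qed

lemma sprk_ge_succ:
  "finite_nonempty_subset B M \<Longrightarrow> splits L M (\<lambda>C. sprk_ge L M C \<alpha>) B \<Longrightarrow> sprk_ge L M B (osucc \<alpha>)"
  by (rule sprk_ge.succ) (auto simp: splits_def)

lemma sprk_ge_imp_finite: "sprk_ge L M B \<alpha> \<Longrightarrow> finite_nonempty_subset B M"
  by (erule sprk_ge.cases) auto

lemma sprk_ge_acl: "sprk_ge L M B \<alpha> \<Longrightarrow> B \<inter> acl_empty L M = {}"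
proof (induction rule: sprk_ge_induct)
  case (succ B \<alpha>)
  then show ?case by (auto elim!: splits_witness)
next
  case (limit B \<alpha>)
  have "0 < \<alpha>"
    using limit(2) zero_ordinal_le[of \<alpha>] unfolding limit_ordinal_def by auto
  then show ?case by (rule limit)
qed

text \<open>In the successor case the extended sets have, by induction, all ranks up to \<alpha>, so
  \<open>B\<close> splits at each \<gamma> \<le> \<alpha>. The ranks \<beta> \<le> \<alpha> of
  \<open>B\<close> itself are then reached from below by a second induction through the three
  rules.\<close>

lemma sprk_ge_mono: "sprk_ge L M B \<alpha> \<Longrightarrow> \<beta> \<le> \<alpha> \<Longrightarrow> sprk_ge L M B \<beta>"
proof (induction arbitrary: \<beta> rule: sprk_ge_induct)
  case (zero B)
  then show ?case
    using zero_ordinal_le[of \<beta>] sprk_ge.zero by (metis order_antisym)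
next
  case (succ B \<alpha>)
  have sp: "splits L M (\<lambda>C. sprk_ge L M C \<gamma>) B" if "\<gamma> \<le> \<alpha>" for \<gamma>
    using succ(2) by (rule splits_mono) (use that in blast)
  have fin: "finite_nonempty_subset B M"
    by (rule succ(1))
  have top: "sprk_ge L M B (osucc \<alpha>)"
    by (intro sprk_ge_succ fin sp) simp
  have "sprk_ge L M B \<beta>" if "\<beta> \<le> \<alpha>" for \<beta>
    using that
  proof (induction \<beta> rule: less_induct)
    case (less \<beta>)
    show ?case
    proof (cases \<beta> rule: ordinal_cases)
      case zero
      then show ?thesis using sprk_ge.zero[OF fin] sprk_ge_acl[OF top] by blast
    next
      case (succ \<gamma>)
      then show ?thesis using less.prems by (auto intro!: sprk_ge_succ fin sp)
    next
      case limit
      then show ?thesis by (rule sprk_ge.limit[OF fin]) (use less in auto)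
    qed
  qed
  then show ?case
    using succ.prems top less_osuccD[of \<beta> \<alpha>] by (cases "\<beta> = osucc \<alpha>") auto
next
  case (limit B \<alpha>)
  show ?case
  proof (cases "\<beta> = \<alpha>")
    case True
    then show ?thesis using sprk_ge.limit[OF limit(1,2,3)] by simp
  next
    case False
    then have "\<beta> < \<alpha>"
      using limit.prems by simp
    then show ?thesis by (rule limit(4)) simp
  qed
qed

text \<open>The inverse of the successor rule. Allowing any \<gamma> below \<alpha> covers limits
  too, where \<open>osucc \<gamma>\<close> is still below \<alpha>.\<close>

lemma sprk_ge_splits:
  "sprk_ge L M B \<alpha> \<Longrightarrow> \<gamma> < \<alpha> \<Longrightarrow> splits L M (\<lambda>C. sprk_ge L M C \<gamma>) B"
proof (induction arbitrary: \<gamma> rule: sprk_ge_induct)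
  case (zero B)
  then show ?case using zero_ordinal_le[of \<gamma>] by auto
next
  case (succ B \<alpha>)
  have "\<gamma> \<le> \<alpha>"
    using succ.prems by (rule less_osuccD)
  show ?case
    using succ(2) by (rule splits_mono) (use sprk_ge_mono[OF _ \<open>\<gamma> \<le> \<alpha>\<close>] in blast)
next
  case (limit B \<alpha>)
  then show ?case
    unfolding limit_ordinal_def by (metis less_osucc)
qed

lemma sprk_ge_subset:
  "sprk_ge L M B \<alpha> \<Longrightarrow> B' \<subseteq> B \<Longrightarrow> B' \<noteq> {} \<Longrightarrow> sprk_ge L M B' \<alpha>"
proof (induction arbitrary: B' rule: sprk_ge_induct)
  case (zero B)
  then show ?case
    by (intro sprk_ge.zero) (auto simp: finite_nonempty_subset_def intro: finite_subset)
next
  case (succ B \<alpha>)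
  have fin: "finite_nonempty_subset B' M"
    using succ by (auto simp: finite_nonempty_subset_def intro: finite_subset)
  show ?case
  proof (rule sprk_ge_succ[OF fin], unfold splits_def, intro allI impI)
    fix bs j and \<phi> :: "('a, 'b) fm"
    assume bs: "distinct bs" "set bs = B'" "j < length bs" "wf_fm L \<phi>" "qfree \<phi>"
      "fv \<phi> \<subseteq> {..<length bs}"
    \<comment> \<open>An enumeration of \<open>B'\<close> is prolonged to one of \<open>B\<close>.
      The added variables do not occur in \<phi>, and an element new to \<open>B\<close> is new to
      \<open>B'\<close>.\<close>
    obtain cs where cs: "set cs = B - B'" "distinct cs"
      using succ(1) finite_distinct_list[of "B - B'"] unfolding finite_nonempty_subset_def by blast
    have "distinct (bs @ cs)" "set (bs @ cs) = B" "j < length (bs @ cs)" "fv \<phi> \<subseteq> {..<length (bs @ cs)}"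
      using bs cs succ.prems by auto
    then obtain b where b: "b \<in> Dom M - B" "sprk_ge L M (B \<union> {b}) \<alpha>"
        "\<And>C. C \<subseteq> B \<union> {b} \<Longrightarrow> C \<noteq> {} \<Longrightarrow> sprk_ge L M C \<alpha>"
        "sat M ((!) (bs @ cs)) \<phi> \<longleftrightarrow> sat M ((!) ((bs @ cs)[j := b])) \<phi>"
      using succ(2) bs(4,5) unfolding splits_def by blast
    have "sat M ((!) (bs @ cs)) \<phi> \<longleftrightarrow> sat M ((!) bs) \<phi>"
      by (rule sat_cong) (use bs(6) in \<open>auto simp: nth_append\<close>)
    moreover have "sat M ((!) ((bs @ cs)[j := b])) \<phi> \<longleftrightarrow> sat M ((!) (bs[j := b])) \<phi>"
      by (rule sat_cong) (use bs(3,6) in \<open>auto simp: nth_append list_update_append\<close>)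
    moreover have "b \<in> Dom M - B'" "sprk_ge L M (B' \<union> {b}) \<alpha>"
      using b(1) succ.prems by (auto intro!: b(3))
    ultimately show "\<exists>b'\<in>Dom M - B'. (sat M ((!) bs) \<phi> \<longleftrightarrow> sat M ((!) (bs[j := b'])) \<phi>) \<and>
        sprk_ge L M (B' \<union> {b'}) \<alpha>"
      using b(4) by blast
  qed
next
  case (limit B \<alpha>)
  have "finite_nonempty_subset B' M"
    using limit.prems limit.hyps(1) by (auto simp: finite_nonempty_subset_def intro: finite_subset)
  then show ?case
    by (rule sprk_ge.limit) (use limit in blast)+
qed

text \<open>The successor in the premise matters: \<open>sprk\<close> is the least bound of ranks
  plus one. If no set had rank at least \<beta>, then \<beta> would already be a bound.\<close>

lemma sprk_ge_of_sprk:
  fixes M :: "('f, 'r, 'm) struct" and \<beta> :: "'m ordinal"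
  assumes unc: "uncountable (UNIV :: 'm set)" and cnt: "countable {..<\<beta>}"
    and rank: "Fin (osucc \<beta>) \<le> sprk L M"
  obtains B where "sprk_ge L M B \<beta>"
proof (rule ccontr)
  assume "\<not> thesis"
  then have no: "\<not> sprk_ge L M B \<beta>" for B
    using that by blast
  have "esucc (sprk_set L M B) \<le> Fin \<beta>" if fin: "finite_nonempty_subset B M" for B
  proof (cases "sprk_ge L M B 0")
    case True
    define \<delta> where "\<delta> = (LEAST \<delta>. \<not> sprk_ge L M B \<delta>)"
    have not_\<delta>: "\<not> sprk_ge L M B \<delta>"
      unfolding \<delta>_def by (rule LeastI, rule no)
    have below: "sprk_ge L M B \<gamma>" if "\<gamma> < \<delta>" for \<gamma>
      using that not_less_Least unfolding \<delta>_def by blast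
    have "\<delta> \<le> \<beta>"
      unfolding \<delta>_def by (rule Least_le, rule no)
    \<comment> \<open>The first rank that fails is neither 0 nor a limit, since at a limit the rule
      \<open>limit\<close> would apply. So a greatest rank exists, and its successor is
      \<delta>.\<close>
    obtain \<gamma> where \<gamma>: "\<gamma> < \<delta>" "\<delta> = osucc \<gamma>"
      using True not_\<delta> sprk_ge.limit[OF fin _ below] by (cases \<delta> rule: ordinal_cases) auto
    have "(GREATEST \<alpha>. sprk_ge L M B \<alpha>) = \<gamma>"
    proof (rule Greatest_equality)
      fix \<alpha> assume "sprk_ge L M B \<alpha>"
      then have "\<alpha> < \<delta>"
        using sprk_ge_mono not_\<delta> by (metis not_less)
      then show "\<alpha> \<le> \<gamma>"
        using \<gamma>(2) less_osuccD by blast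
    qed (use below \<gamma> in blast)
    then show ?thesis
      using True no \<open>\<delta> \<le> \<beta>\<close> \<gamma> by (auto simp: sprk_set_def)
  qed (simp add: sprk_set_def)
  then have "sprk L M \<le> Fin \<beta>"
    unfolding sprk_def Let_def by (auto intro: Least_le)
  then have "osucc \<beta> \<le> \<beta>"
    using rank by (metis less_eq_extended.simps(1) order_trans)
  then show False
    using countable_osucc(1)[OF unc cnt] by simp
qed


section \<open>Trees of tuples of high rank\<close>

definition entails :: "'m itself \<Rightarrow> ('f, 'r) fm \<Rightarrow> ('f, 'r) fm \<Rightarrow> bool" where
  "entails _ \<phi> \<psi> \<longleftrightarrow> (\<forall>(M :: ('f, 'r, 'm) struct) v. sat M v \<phi> \<longrightarrow> sat M v \<psi>)"

text \<open>The element with index \<open>n\<close> is split off from the one with index \<open>n - 2 ^ \<lfloor>log 2 n\<rfloor>\<close>. Hence the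
  indices below \<open>2 ^ l\<close> are the binary strings of length \<open>l\<close>, least significant digit first, and
  reduction modulo \<open>2 ^ m\<close> is restriction to length \<open>m\<close>.\<close>

lemma ex_parent:
  fixes n :: nat
  assumes "0 < n"
  obtains p where "p < n" "\<And>m. 2 ^ m \<le> n \<Longrightarrow> p mod 2 ^ m = n mod 2 ^ m"
proof -
  obtain e where e: "2 ^ e \<le> n" "n < 2 ^ (e + 1)"
    using ex_power_ivl1[of 2 n] assms by auto
  have "(n - 2 ^ e) mod 2 ^ m = n mod 2 ^ m" if "2 ^ m \<le> n" for m
  proof -
    have "(2 :: nat) ^ m < 2 ^ (e + 1)"
      using that e by linarith
    then have "(2 :: nat) ^ m dvd 2 ^ e"
      by (intro le_imp_power_dvd) (simp add: power_strict_increasing_iff flip: power_Suc)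
    then show ?thesis
      using e(1) by (metis le_add_diff_inverse2 dvd_def mod_mult_self2)
  qed
  moreover have "n - 2 ^ e < n"
    using assms by simp
  ultimately show thesis
    using that by blast
qed

locale high_rank_models =
  fixes L :: "('f, 'r) lang" and T \<Delta> :: "('f, 'r) fm set" and U :: "'u itself"
  assumes uncountable_universe: "uncountable (UNIV :: 'u set)"
    and qe: "has_quantifier_elimination U L T"
    and high_rank: "\<And>\<alpha> :: 'u ordinal. countable {..<\<alpha>} \<Longrightarrow>
           \<exists>M :: ('f, 'r, 'u) struct. models L M T \<and> omits M \<Delta> \<and> sprk L M \<ge> Fin \<alpha>"
begin

definition model :: "('f, 'r, 'u) struct \<Rightarrow> bool" where
  "model M \<longleftrightarrow> models L M T \<and> omits M \<Delta>"

text \<open>Assignments are total with all values in the domain, also beyond \<open>n\<close>, since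
  elimination and coverings are stated for such assignments.\<close>

definition realized :: "nat \<Rightarrow> ('f, 'r) fm \<Rightarrow> bool" where
  "realized n \<phi> \<longleftrightarrow> wf_fm L \<phi> \<and> fv \<phi> \<subseteq> {..<n} \<and>
     (\<forall>\<alpha> :: 'u ordinal. countable {..<\<alpha>} \<longrightarrow>
       (\<exists>M b. model M \<and> range b \<subseteq> Dom M \<and> inj_on b {..<n} \<and>
         sprk_ge L M (b ` {..<n}) \<alpha> \<and> sat M b \<phi>))"

text \<open>One element of a set of high rank suffices, as rank does not drop on non-empty
  subsets.\<close>

lemma realized_init: "realized 1 (Neg Bot)"
  unfolding realized_def
proof (intro conjI allI impI)
  fix \<alpha> :: "'u ordinal"
  assume \<alpha>: "countable {..<\<alpha>}"
  obtain M :: "('f, 'r, 'u) struct" where M: "model M" "Fin (osucc \<alpha>) \<le> sprk L M"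
    using high_rank[OF countable_osucc(2)[OF uncountable_universe \<alpha>]] unfolding model_def by blast
  obtain B where B: "sprk_ge L M B \<alpha>"
    using sprk_ge_of_sprk[OF uncountable_universe \<alpha> M(2)] .
  then obtain a where a: "a \<in> B" "a \<in> Dom M"
    using sprk_ge_imp_finite unfolding finite_nonempty_subset_def by blast
  have "sprk_ge L M {a} \<alpha>"
    using B by (rule sprk_ge_subset) (use a in auto)
  then show "\<exists>M b. model M \<and> range b \<subseteq> Dom M \<and> inj_on b {..<1} \<and>
      sprk_ge L M (b ` {..<1}) \<alpha> \<and> sat M b (Neg Bot)"
    using M a by (intro exI[of _ M] exI[of _ "\<lambda>_. a"]) (auto simp: image_constant_conv inj_on_def)
qed auto

text \<open>One split costs one level of rank, which is harmless because \<alpha> ranges over all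
  countable ordinals. The new element gets the variable \<open>n\<close>, and the renaming reads
  \<phi> with it in the place of \<open>p\<close>.\<close>

lemma realized_split:
  assumes "realized n \<phi>" "p < n"
  shows "realized (Suc n) (And \<phi> (ren (id(p := n)) \<phi>))"
  unfolding realized_def
proof (intro conjI allI impI)
  have \<phi>: "wf_fm L \<phi>" "fv \<phi> \<subseteq> {..<n}"
    using assms(1) unfolding realized_def by auto
  then show "wf_fm L (And \<phi> (ren (id(p := n)) \<phi>))"
    by simp
  show "fv (And \<phi> (ren (id(p := n)) \<phi>)) \<subseteq> {..<Suc n}"
    using \<phi>(2) fv_ren[of "id(p := n)" \<phi>] by (fastforce split: if_splits)
  fix \<alpha> :: "'u ordinal"
  assume "countable {..<\<alpha>}"
  note succ = countable_osucc[OF uncountable_universe this]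
  obtain M b where M: "model M" "range b \<subseteq> Dom M" "inj_on b {..<n}"
      "sprk_ge L M (b ` {..<n}) (osucc \<alpha>)" "sat M b \<phi>"
    using assms(1) succ(2) unfolding realized_def by blast
  \<comment> \<open>Splitting controls quantifier-free formulas only, so \<phi> is traded for an
    equivalent one of that kind.\<close>
  obtain \<psi> where \<psi>: "wf_fm L \<psi>" "qfree \<psi>" "fv \<psi> \<subseteq> fv \<phi>"
      "\<And>v. range v \<subseteq> Dom M \<Longrightarrow> sat M v \<phi> \<longleftrightarrow> sat M v \<psi>"
    using qe \<phi>(1) M(1) unfolding has_quantifier_elimination_def model_def by metis
  have fv\<psi>: "fv \<psi> \<subseteq> {..<n}"
    using \<psi>(3) \<phi>(2) by blast
  let ?bs = "map b [0..<n]"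
  have bs: "distinct ?bs" "set ?bs = b ` {..<n}" "p < length ?bs" "fv \<psi> \<subseteq> {..<length ?bs}"
    using M(3) assms(2) fv\<psi> by (auto simp: distinct_map atLeast0LessThan)
  obtain b' where b': "b' \<in> Dom M - b ` {..<n}"
      "sat M ((!) ?bs) \<psi> \<longleftrightarrow> sat M ((!) (?bs[p := b'])) \<psi>" "sprk_ge L M (b ` {..<n} \<union> {b'}) \<alpha>"
    using sprk_ge_splits[OF M(4) succ(1), unfolded splits_def, rule_format, OF bs(1,2,3) \<psi>(1,2) bs(4)]
    by (elim bexE conjE)
  have rb: "range (b(p := b')) \<subseteq> Dom M"
    using M(2) b'(1) by auto
  have "sat M b \<psi>"
    using M(2,5) \<psi>(4) by blast
  also have "sat M b \<psi> \<longleftrightarrow> sat M ((!) ?bs) \<psi>"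
    by (rule sat_cong) (use fv\<psi> in auto)
  also have "\<dots> \<longleftrightarrow> sat M ((!) (?bs[p := b'])) \<psi>"
    by (rule b'(2))
  also have "\<dots> \<longleftrightarrow> sat M (b(p := b')) \<psi>"
    by (rule sat_cong) (use fv\<psi> assms(2) in \<open>auto simp: nth_list_update\<close>)
  also have "\<dots> \<longleftrightarrow> sat M (b(p := b')) \<phi>"
    using \<psi>(4)[OF rb] by simp
  also have "\<dots> \<longleftrightarrow> sat M (b(n := b') \<circ> id(p := n)) \<phi>"
    by (rule sat_cong) (use \<phi>(2) in auto)
  finally have "sat M (b(n := b')) (ren (id(p := n)) \<phi>)"
    by (simp only: sat_ren)
  moreover have "sat M (b(n := b')) \<phi> \<longleftrightarrow> sat M b \<phi>"
    by (rule sat_cong) (use \<phi>(2) in auto)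
  moreover have "b(n := b') ` {..<Suc n} = b ` {..<n} \<union> {b'}"
    by (auto simp: lessThan_Suc)
  moreover have "inj_on (b(n := b')) {..<Suc n}"
    using M(3) b'(1) by (auto simp: lessThan_Suc inj_on_def)
  ultimately show "\<exists>M b. model M \<and> range b \<subseteq> Dom M \<and> inj_on b {..<Suc n} \<and>
      sprk_ge L M (b ` {..<Suc n}) \<alpha> \<and> sat M b (And \<phi> (ren (id(p := n)) \<phi>))"
    using M(1,2,5) b'(1,3) by (intro exI[of _ M] exI[of _ "b(n := b')"]) auto
qed

section \<open>Deciding countable coverings\<close>

definition covering :: "nat \<Rightarrow> ('f, 'r) fm set \<Rightarrow> bool" where
  "covering n X \<longleftrightarrow> countable X \<and> (\<forall>\<theta>\<in>X. wf_fm L \<theta> \<and> fv \<theta> \<subseteq> {..<n}) \<and>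
     (\<forall>M b. model M \<longrightarrow> range b \<subseteq> Dom M \<longrightarrow> (\<exists>\<theta>\<in>X. sat M b \<theta>))"

text \<open>If every \<theta> failed at some countable rank, a tuple realizing \<phi> at a rank
  above all these failures would still satisfy one of them, and by monotonicity it also has the rank
  at which that \<theta> was to fail.\<close>

lemma realized_refine:
  assumes "realized n \<phi>" "covering n X"
  shows "\<exists>\<theta>\<in>X. realized n (And \<phi> \<theta>)"
proof (rule ccontr)
  let ?R = "\<lambda>\<theta> (\<alpha> :: 'u ordinal) M b. model M \<and> range b \<subseteq> Dom M \<and> inj_on b {..<n} \<and>
         sprk_ge L M (b ` {..<n}) \<alpha> \<and> sat M b \<theta>"
  assume none: "\<not> ?thesis"
  have "\<forall>\<theta>\<in>X. \<exists>\<alpha> :: 'u ordinal. countable {..<\<alpha>} \<and> (\<forall>M b. \<not> ?R (And \<phi> \<theta>) \<alpha> M b)"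
  proof (intro ballI)
    fix \<theta> assume \<theta>: "\<theta> \<in> X"
    have "wf_fm L (And \<phi> \<theta>)" "fv (And \<phi> \<theta>) \<subseteq> {..<n}"
      using assms \<theta> unfolding realized_def covering_def by auto
    moreover have "\<not> realized n (And \<phi> \<theta>)"
      using none \<theta> by blast
    ultimately show "\<exists>\<alpha> :: 'u ordinal. countable {..<\<alpha>} \<and> (\<forall>M b. \<not> ?R (And \<phi> \<theta>) \<alpha> M b)"
      unfolding realized_def by blast
  qed
  then obtain \<alpha> :: "('f, 'r) fm \<Rightarrow> 'u ordinal" where
    \<alpha>: "\<And>\<theta>. \<theta> \<in> X \<Longrightarrow> countable {..<\<alpha> \<theta>}" "\<And>\<theta> M b. \<theta> \<in> X \<Longrightarrow> \<not> ?R (And \<phi> \<theta>) (\<alpha> \<theta>) M b"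
    by metis
  have cnt: "countable (\<alpha> ` X)"
    using assms(2) unfolding covering_def by (intro countable_image) simp
  obtain \<beta> where \<beta>: "countable {..<\<beta>}" "\<And>\<theta>. \<theta> \<in> X \<Longrightarrow> \<alpha> \<theta> < \<beta>"
    by (rule countable_bound[OF uncountable_universe cnt]) (use \<alpha>(1) in auto)
  obtain M b where M: "?R \<phi> \<beta> M b"
    using assms(1) \<beta>(1) unfolding realized_def by blast
  then obtain \<theta> where \<theta>: "\<theta> \<in> X" "sat M b \<theta>"
    using assms(2) unfolding covering_def by blast
  have "sprk_ge L M (b ` {..<n}) (\<alpha> \<theta>)"
    using M sprk_ge_mono less_imp_le[OF \<beta>(2)[OF \<theta>(1)]] by blast
  then show False
    using \<alpha>(2)[OF \<theta>(1), of M b] M \<theta>(2) by simp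
qed

lemma realized_refine_finite:
  assumes "finite XX" "realized n \<phi>" "\<And>X. X \<in> XX \<Longrightarrow> covering n X"
  shows "\<exists>\<phi>'. realized n \<phi>' \<and> entails U \<phi>' \<phi> \<and> (\<forall>X\<in>XX. \<exists>\<theta>\<in>X. entails U \<phi>' \<theta>)"
  using assms(1,3)
proof (induction XX rule: finite_induct)
  case empty
  then show ?case using assms(2) by (auto simp: entails_def)
next
  case (insert X XX)
  then obtain \<phi>' where \<phi>': "realized n \<phi>'" "entails U \<phi>' \<phi>" "\<forall>X\<in>XX. \<exists>\<theta>\<in>X. entails U \<phi>' \<theta>"
    by auto
  then obtain \<theta> where \<theta>: "\<theta> \<in> X" "realized n (And \<phi>' \<theta>)"
    using realized_refine insert.prems by blast
  have "entails U (And \<phi>' \<theta>) \<theta>" "\<And>\<psi>. entails U \<phi>' \<psi> \<Longrightarrow> entails U (And \<phi>' \<theta>) \<psi>"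
    by (simp_all add: entails_def)
  then show ?case
    using \<theta> \<phi>' by blast
qed

text \<open>Bookkeeping of the construction. A task is a covering in \<open>fst (task i)\<close>
  variables; from stage \<open>i\<close> on it is settled for every placement of these variables
  among the elements present. Only finitely many tasks and placements are due at each stage.\<close>

lemma realized_sequence:
  fixes task :: "nat \<Rightarrow> nat \<times> ('f, 'r) fm set"
  assumes "\<And>i. covering (fst (task i)) (snd (task i))"
  obtains \<phi> p where "\<And>n. realized (Suc n) (\<phi> n)" "\<And>n. entails U (\<phi> (Suc n)) (\<phi> n)"
    "\<And>n. entails U (\<phi> (Suc n)) (ren (id(p n := Suc n)) (\<phi> n))"
    "\<And>n. p n < Suc n" "\<And>n m. 2 ^ m \<le> Suc n \<Longrightarrow> p n mod 2 ^ m = Suc n mod 2 ^ m"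
    "\<And>n i \<rho>. i \<le> n \<Longrightarrow> (\<And>j. j < fst (task i) \<Longrightarrow> \<rho> j < Suc n) \<Longrightarrow>
       \<exists>\<theta>\<in>snd (task i). entails U (\<phi> n) (ren \<rho> \<theta>)"
proof -
  \<comment> \<open>The value 0 off the first \<open>k\<close> variables makes the set of placements
    finite without affecting formulas in those variables.\<close>
  define R :: "nat \<Rightarrow> nat \<Rightarrow> (nat \<Rightarrow> nat) set" where
    "R k n = {\<rho>. \<forall>j. (j \<in> {..<k} \<longrightarrow> \<rho> j \<in> {..<n}) \<and> (j \<notin> {..<k} \<longrightarrow> \<rho> j = 0)}" for k n
  define XX where "XX n = (\<Union>i\<le>n. (\<lambda>\<rho>. ren \<rho> ` snd (task i)) ` R (fst (task i)) (Suc n))" for n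
  have finR: "finite (R k n)" for k n
    unfolding R_def by (rule finite_set_of_finite_funs) auto
  then have finXX: "finite (XX n)" for n
    unfolding XX_def by blast
  have cov: "covering (Suc n) X" if X: "X \<in> XX n" for n X
  proof -
    obtain i \<rho> where i: "X = ren \<rho> ` snd (task i)" "\<rho> \<in> R (fst (task i)) (Suc n)"
      using X unfolding XX_def by blast
    have "fv (ren \<rho> \<theta>) \<subseteq> {..<Suc n}" if "\<theta> \<in> snd (task i)" for \<theta>
    proof -
      have "fv \<theta> \<subseteq> {..<fst (task i)}"
        using assms[of i] that unfolding covering_def by blast
      then show ?thesis
        using fv_ren[of \<rho> \<theta>] i(2) unfolding R_def by blast
    qed
    moreover have "\<exists>\<theta>\<in>snd (task i). sat M (b \<circ> \<rho>) \<theta>" if "model M" "range b \<subseteq> Dom M" for M b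
    proof -
      have "range (b \<circ> \<rho>) \<subseteq> Dom M"
        using that(2) by auto
      then show ?thesis
        using assms[of i] that(1) unfolding covering_def by blast
    qed
    ultimately show ?thesis
      using assms[of i] unfolding covering_def i(1) by (auto simp del: o_apply)
  qed
  have refine: "\<exists>\<phi>'. realized (Suc n) \<phi>' \<and> entails U \<phi>' \<phi> \<and> (\<forall>X\<in>XX n. \<exists>\<theta>\<in>X. entails U \<phi>' \<theta>)"
    if "realized (Suc n) \<phi>" for n \<phi>
    using realized_refine_finite[OF finXX that cov] by blast
  obtain p :: "nat \<Rightarrow> nat" where p: "\<And>n. p n < Suc n"
      "\<And>n m. 2 ^ m \<le> Suc n \<Longrightarrow> p n mod 2 ^ m = Suc n mod 2 ^ m"
  proof -
    have "\<exists>p. \<forall>n. p n < Suc n \<and> (\<forall>m. 2 ^ m \<le> Suc n \<longrightarrow> p n mod 2 ^ m = Suc n mod 2 ^ m)"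
      by (intro choice allI) (use ex_parent[of "Suc n" for n] in blast)
    then show thesis
      using that by blast
  qed
  let ?P = "\<lambda>n \<phi>. realized (Suc n) \<phi> \<and> (\<forall>X\<in>XX n. \<exists>\<theta>\<in>X. entails U \<phi> \<theta>)"
  let ?Q = "\<lambda>n \<phi> \<phi>'. entails U \<phi>' \<phi> \<and> entails U \<phi>' (ren (id(p n := Suc n)) \<phi>)"
  have "\<exists>\<phi>. \<forall>n. ?P n (\<phi> n) \<and> ?Q n (\<phi> n) (\<phi> (Suc n))"
  proof (rule dependent_nat_choice)
    show "\<exists>\<phi>. ?P 0 \<phi>"
      using refine[of 0 "Neg Bot"] realized_init by auto
    fix \<phi> n assume P: "?P n \<phi>"
    \<comment> \<open>The new element is split off from its parent before the tasks due for the
      enlarged tuple are settled.\<close>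
    obtain \<phi>' where "realized (Suc (Suc n)) \<phi>'"
        "entails U \<phi>' (And \<phi> (ren (id(p n := Suc n)) \<phi>))" "\<forall>X\<in>XX (Suc n). \<exists>\<theta>\<in>X. entails U \<phi>' \<theta>"
      using refine[OF realized_split[OF conjunct1[OF P] p(1)]] by blast
    then show "\<exists>\<phi>'. ?P (Suc n) \<phi>' \<and> ?Q n \<phi> \<phi>'"
      by (intro exI[of _ \<phi>']) (simp add: entails_def)
  qed
  then obtain \<phi> where P: "\<And>n. ?P n (\<phi> n)" and Q: "\<And>n. ?Q n (\<phi> n) (\<phi> (Suc n))"
    by blast
  have "\<exists>\<theta>\<in>snd (task i). entails U (\<phi> n) (ren \<rho> \<theta>)"
    if "i \<le> n" and \<rho>: "\<And>j. j < fst (task i) \<Longrightarrow> \<rho> j < Suc n" for n i \<rho>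
  proof -
    define \<rho>' where "\<rho>' j = (if j < fst (task i) then \<rho> j else 0)" for j
    have "\<rho>' \<in> R (fst (task i)) (Suc n)"
      using \<rho> unfolding R_def \<rho>'_def by auto
    then have "ren \<rho>' ` snd (task i) \<in> XX n"
      unfolding XX_def using \<open>i \<le> n\<close> by blast
    then obtain \<theta> where \<theta>: "\<theta> \<in> snd (task i)" "entails U (\<phi> n) (ren \<rho>' \<theta>)"
      using P[of n] by blast
    have "fv \<theta> \<subseteq> {..<fst (task i)}"
      using assms[of i] \<theta>(1) unfolding covering_def by blast
    then have "sat M (v \<circ> \<rho>') \<theta> \<longleftrightarrow> sat M (v \<circ> \<rho>) \<theta>" for M :: "('f, 'r, 'u) struct" and v
      by (intro sat_cong) (auto simp: \<rho>'_def)
    then show ?thesis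
      using \<theta> unfolding entails_def by (simp only: sat_ren) blast
  qed
  then show thesis
    using P Q p by (intro that[of \<phi> p]) blast+
qed

text \<open>The map \<open>f\<close> moves every node of level \<open>m\<close> to a node above it
  at level \<open>l\<close>. Since \<theta> is chosen before \<open>l\<close> and \<open>f\<close>,
  one decision at level \<open>m\<close> holds for all extensions of the nodes selected by
  \<rho>.\<close>

lemma tree_of_models:
  fixes task :: "nat \<Rightarrow> nat \<times> ('f, 'r) fm set"
  assumes "\<And>i. covering (fst (task i)) (snd (task i))"
  obtains M b where "\<And>l. model (M l)" "\<And>l. range (b l) \<subseteq> Dom (M l)" "\<And>l. inj_on (b l) {..<2 ^ l}"
    "\<And>i. \<exists>n. \<forall>m\<ge>n. \<forall>\<rho> :: nat \<Rightarrow> nat. (\<forall>j. \<rho> j < 2 ^ m) \<longrightarrow>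
       (\<exists>\<theta>\<in>snd (task i). \<forall>l\<ge>m. \<forall>f :: nat \<Rightarrow> nat.
         (\<forall>j<2 ^ m. f j < 2 ^ l \<and> f j mod 2 ^ m = j) \<longrightarrow>
          sat (M l) (b l \<circ> f \<circ> \<rho>) \<theta>)"
proof (rule realized_sequence[of task, OF assms])
  fix \<phi> p
  assume real: "\<And>n. realized (Suc n) (\<phi> n)"
    and mono: "\<And>n. entails U (\<phi> (Suc n)) (\<phi> n)"
    and split: "\<And>n. entails U (\<phi> (Suc n)) (ren (id(p n := Suc n)) (\<phi> n))"
    and p: "\<And>n. p n < Suc n" "\<And>n m. 2 ^ m \<le> Suc n \<Longrightarrow> p n mod 2 ^ m = Suc n mod 2 ^ m"
    and task: "\<And>n i \<rho>. i \<le> n \<Longrightarrow> (\<And>j. j < fst (task i) \<Longrightarrow> \<rho> j < Suc n) \<Longrightarrow>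
       \<exists>\<theta>\<in>snd (task i). entails U (\<phi> n) (ren \<rho> \<theta>)"
  \<comment> \<open>\<open>\<phi> n\<close> speaks of the elements 0 to \<open>n\<close>, and the
    last node of level \<open>m\<close> is \<open>2 ^ m - 1\<close>.\<close>
  let ?\<phi> = "\<lambda>m. \<phi> (2 ^ m - 1)"
  have fv: "fv (?\<phi> m) \<subseteq> {..<2 ^ m}" for m
    using real[of "2 ^ m - 1"] unfolding realized_def by simp
  \<comment> \<open>Elements are removed from the top. If \<open>f\<close> hits the newest element,
    the split clause allows replacing it by its parent; otherwise monotonicity suffices. After all
    removals \<open>f\<close> is the identity below \<open>2 ^ m\<close>.\<close>
  have descend: "sat M (v \<circ> f) (?\<phi> m)"
    if "2 ^ m - 1 \<le> n" "\<And>j. j < 2 ^ m \<Longrightarrow> f j \<le> n \<and> f j mod 2 ^ m = j" "sat M v (\<phi> n)"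
    for M :: "('f, 'r, 'u) struct" and m n f v
    using that
  proof (induction n arbitrary: f v rule: dec_induct)
    case base
    have "f j = j" if "j < 2 ^ m" for j
    proof -
      have "f j < 2 ^ m"
        using base(1)[OF that] that by auto
      then show ?thesis
        using base(1)[OF that] by simp
    qed
    then have "sat M (v \<circ> f) (?\<phi> m) \<longleftrightarrow> sat M v (?\<phi> m)"
      by (intro sat_cong) (use fv[of m] in auto)
    then show ?case
      using base(2) by blast
  next
    case (step n)
    have n: "2 ^ m \<le> Suc n"
      using step.hyps by simp
    let ?i = "Suc n mod 2 ^ m"
    have i: "?i < 2 ^ m"
      by simp
    show ?case
    proof (cases "f ?i = Suc n")
      case True
      let ?f = "f(?i := p n)"
      \<comment> \<open>Residues modulo \<open>2 ^ m\<close> show that only the node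
        \<open>?i\<close> can be moved to \<open>Suc n\<close> or to its parent
        \<open>p n\<close>.\<close>
      have f: "f j \<noteq> Suc n \<and> f j \<noteq> p n" if "j < 2 ^ m" "j \<noteq> ?i" for j
        using step.prems(1)[OF that(1)] that(2) p(2)[OF n] by metis
      have "sat M (v \<circ> id(p n := Suc n)) (\<phi> n)"
        using split[of n] step.prems(2) unfolding entails_def by (simp only: sat_ren)
      then have "sat M (v \<circ> id(p n := Suc n) \<circ> ?f) (?\<phi> m)"
      proof (rule step.IH[rotated])
        fix j :: nat assume j: "j < 2 ^ m"
        show "?f j \<le> n \<and> ?f j mod 2 ^ m = j"
        proof (cases "j = ?i")
          case True
          then show ?thesis using p(1)[of n] p(2)[OF n] by simp
        next
          case False
          then show ?thesis using step.prems(1)[OF j] f[OF j] by (auto simp: le_Suc_eq)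
        qed
      qed
      also have "sat M (v \<circ> id(p n := Suc n) \<circ> ?f) (?\<phi> m) \<longleftrightarrow> sat M (v \<circ> f) (?\<phi> m)"
      proof (rule sat_cong)
        fix j assume "j \<in> fv (?\<phi> m)"
        then have j: "j < 2 ^ m"
          using fv[of m] by blast
        show "(v \<circ> id(p n := Suc n) \<circ> ?f) j = (v \<circ> f) j"
          using True f[OF j] by auto
      qed
      finally show ?thesis .
    next
      case False
      have "f j \<le> n \<and> f j mod 2 ^ m = j" if "j < 2 ^ m" for j
        using step.prems(1)[OF that] False by (metis le_Suc_eq)
      moreover have "sat M v (\<phi> n)"
        using mono[of n] step.prems(2) unfolding entails_def by blast
      ultimately show ?thesis
        by (rule step.IH)
    qed
  qed
  have "\<exists>M b. model M \<and> range b \<subseteq> Dom M \<and> inj_on b {..<2 ^ l} \<and> sat M b (?\<phi> l)" for l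
  proof -
    \<comment> \<open>High rank has served its purpose: any realization of \<open>?\<phi> l\<close>
      will do, so rank 0 is requested.\<close>
    have "countable {..<0 :: 'u ordinal}"
      using zero_ordinal_le by (metis countable_empty ex_in_conv lessThan_iff not_le)
    moreover have "realized (2 ^ l) (?\<phi> l)"
      using real[of "2 ^ l - 1"] by simp
    ultimately show ?thesis
      unfolding realized_def by blast
  qed
  then obtain M b where Mb: "\<And>l. model (M l)" "\<And>l. range (b l) \<subseteq> Dom (M l)"
      "\<And>l. inj_on (b l) {..<2 ^ l}" "\<And>l. sat (M l) (b l) (?\<phi> l)"
    by metis
  show thesis
  proof (rule that[of M b])
    fix i
    show "\<exists>n. \<forall>m\<ge>n. \<forall>\<rho> :: nat \<Rightarrow> nat. (\<forall>j. \<rho> j < 2 ^ m) \<longrightarrow>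
       (\<exists>\<theta>\<in>snd (task i). \<forall>l\<ge>m. \<forall>f :: nat \<Rightarrow> nat.
         (\<forall>j<2 ^ m. f j < 2 ^ l \<and> f j mod 2 ^ m = j) \<longrightarrow>
          sat (M l) (b l \<circ> f \<circ> \<rho>) \<theta>)"
    proof (intro exI[of _ i] allI impI)
      fix m and \<rho> :: "nat \<Rightarrow> nat"
      assume m: "i \<le> m" and \<rho>: "\<forall>j. \<rho> j < (2 :: nat) ^ m"
      \<comment> \<open>Stage \<open>2 ^ m - 1\<close> is at least \<open>m\<close>, so task
        \<open>i\<close> is already settled there.\<close>
      have "m < 2 ^ m"
        by (rule less_exp)
      then have "i \<le> 2 ^ m - 1"
        using m by linarith
      then obtain \<theta> where \<theta>: "\<theta> \<in> snd (task i)" "entails U (?\<phi> m) (ren \<rho> \<theta>)"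
        using task[of i "2 ^ m - 1" \<rho>] \<rho> by auto
      have "sat (M l) (b l \<circ> f \<circ> \<rho>) \<theta>"
        if "m \<le> l" "\<forall>j<2 ^ m. f j < 2 ^ l \<and> f j mod 2 ^ m = j" for l and f :: "nat \<Rightarrow> nat"
      proof -
        have "(2 :: nat) ^ m \<le> 2 ^ l"
          using that(1) by (rule power_increasing) simp
        then have "2 ^ m - 1 \<le> (2 :: nat) ^ l - 1"
          by linarith
        moreover have "f j \<le> 2 ^ l - 1 \<and> f j mod 2 ^ m = j" if "j < 2 ^ m" for j
        proof -
          have "f j < 2 ^ l" "f j mod 2 ^ m = j"
            using \<open>\<forall>j<2 ^ m. f j < 2 ^ l \<and> f j mod 2 ^ m = j\<close> that by blast+
          then show ?thesis
            by linarith
        qed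
        ultimately have "sat (M l) (b l \<circ> f) (?\<phi> m)"
          using Mb(4)[of l] by (rule descend)
        then show ?thesis
          using \<theta>(2) unfolding entails_def by (simp only: sat_ren)
      qed
      then show "\<exists>\<theta>\<in>snd (task i). \<forall>l\<ge>m. \<forall>f :: nat \<Rightarrow> nat.
         (\<forall>j<2 ^ m. f j < 2 ^ l \<and> f j mod 2 ^ m = j) \<longrightarrow>
          sat (M l) (b l \<circ> f \<circ> \<rho>) \<theta>"
        using \<theta>(1) by blast
    qed
  qed (use Mb in auto)
qed

end


section \<open>Definable limits of branches\<close>

text \<open>All that the limit needs from the tree; ranks have disappeared. The second case of
  \<open>branch_omits\<close> is meant for a \<psi> with exactly one solution, which then refutes a
  fixed \<delta>. \<open>universe\<close> leaves room in \<open>'u\<close> for the limit.\<close>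

locale branching_models =
  fixes L :: "('f, 'r) lang" and T \<Delta> :: "('f, 'r) fm set" and U :: "'u itself"
    and M :: "nat \<Rightarrow> ('f, 'r, 'u) struct" and branch :: "(nat \<Rightarrow> bool) \<Rightarrow> nat \<Rightarrow> 'u"
  assumes countable_L: "countable_lang L"
    and theory_T: "is_theory L T"
    and type_\<Delta>: "is_partial_1type L \<Delta>"
    and skolem: "has_definable_Skolem_functions U L T"
    and universe: "(UNIV :: (nat \<Rightarrow> bool) set) \<lesssim> (UNIV :: 'u set)"
    and models_M: "models L (M l) T"
    and branch_Dom: "branch \<eta> l \<in> Dom (M l)"
    and branch_neq: "\<eta> \<noteq> \<tau> \<Longrightarrow> \<forall>\<^sub>F l in sequentially. branch \<eta> l \<noteq> branch \<tau> l"
    and branch_decided: "wf_fm L \<theta> \<Longrightarrow>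
      (\<forall>\<^sub>F l in sequentially. sat (M l) (\<lambda>i. branch (h i) l) \<theta>) \<or>
      (\<forall>\<^sub>F l in sequentially. \<not> sat (M l) (\<lambda>i. branch (h i) l) \<theta>)"
    and branch_omits: "wf_fm L \<psi> \<Longrightarrow>
      (\<forall>\<^sub>F l in sequentially. sat (M l) (\<lambda>i. branch (h i) l) (Neg (Ex 0 \<psi>))) \<or>
      (\<exists>\<delta>\<in>\<Delta>. \<forall>\<^sub>F l in sequentially. sat (M l) (\<lambda>i. branch (h i) l) (Ex 0 (And \<psi> (Neg \<delta>))))"
    and branch_similar: "wf_fm L \<theta> \<Longrightarrow> fv \<theta> \<subseteq> {..<k} \<Longrightarrow>
      \<exists>n. \<forall>l\<ge>n. \<forall>\<eta>s \<tau>s. length \<eta>s = k \<longrightarrow> similar_mod l \<eta>s \<tau>s \<longrightarrow>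
        ((\<forall>\<^sub>F j in sequentially. sat (M j) (\<lambda>i. branch (\<eta>s ! i) j) \<theta>) \<longleftrightarrow>
         (\<forall>\<^sub>F j in sequentially. sat (M j) (\<lambda>i. branch (\<tau>s ! i) j) \<theta>))"
begin

text \<open>Variable 0 is the value and variable \<open>i + 1\<close> the branch \<open>h i\<close>.
  Requiring the definition only eventually makes definability invariant under eventual equality
  within the domains.\<close>

definition defined_by :: "('f, 'r) fm \<Rightarrow> (nat \<Rightarrow> nat \<Rightarrow> bool) \<Rightarrow> (nat \<Rightarrow> 'u) \<Rightarrow> bool" where
  "defined_by \<psi> h g \<longleftrightarrow> wf_fm L \<psi> \<and> (\<forall>\<^sub>F l in sequentially. \<forall>y\<in>Dom (M l).
     sat (M l) (case_nat y (\<lambda>i. branch (h i) l)) \<psi> \<longleftrightarrow> y = g l)"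

definition definable :: "(nat \<Rightarrow> 'u) \<Rightarrow> bool" where
  "definable g \<longleftrightarrow> (\<forall>l. g l \<in> Dom (M l)) \<and> (\<exists>\<psi> h. defined_by \<psi> h g)"

lemma structure_M: "is_structure L (M l)"
  using models_M unfolding models_def by blast

lemma definable_Dom: "definable g \<Longrightarrow> g l \<in> Dom (M l)"
  unfolding definable_def by blast

lemma definable_cong:
  assumes "definable g" "\<forall>\<^sub>F l in sequentially. g' l = g l" "\<And>l. g' l \<in> Dom (M l)"
  shows "definable g'"
proof -
  obtain \<psi> h where "wf_fm L \<psi>" "\<forall>\<^sub>F l in sequentially. \<forall>y\<in>Dom (M l).
      sat (M l) (case_nat y (\<lambda>i. branch (h i) l)) \<psi> \<longleftrightarrow> y = g l"
    using assms(1) unfolding definable_def defined_by_def by blast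
  then have "defined_by \<psi> h g'"
    unfolding defined_by_def using assms(2) by (auto elim: eventually_elim2)
  then show ?thesis
    unfolding definable_def using assms(3) by blast
qed

text \<open>Each \<open>v x\<close> in \<theta> is replaced by an existentially quantified variable
  subject to its defining formula. A formula has finitely many free variables, so finitely many
  steps suffice and their equivalences eventually hold together.\<close>

lemma definable_compose:
  assumes "wf_fm L \<theta>" "\<And>i. definable (v i)"
  obtains \<theta>' h where "wf_fm L \<theta>'" "\<forall>\<^sub>F l in sequentially. \<forall>y\<in>Dom (M l).
      sat (M l) (case_nat y (\<lambda>i. v i l)) \<theta> \<longleftrightarrow> sat (M l) (case_nat y (\<lambda>i. branch (h i) l)) \<theta>'"
proof -
  obtain \<psi> hh where "\<And>x. defined_by (\<psi> x) (hh x) (v x)"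
    using assms(2) unfolding definable_def by metis
  then have \<psi>: "wf_fm L (\<psi> x)" "\<forall>\<^sub>F l in sequentially. \<forall>a\<in>Dom (M l).
      sat (M l) (case_nat a (\<lambda>i. branch (hh x i) l)) (\<psi> x) \<longleftrightarrow> a = v x l" for x
    unfolding defined_by_def by auto
  \<comment> \<open>The branch parameters of all the definitions are merged into one family by
    pairing.\<close>
  define h where "h j = (case prod_decode j of (x, i) \<Rightarrow> hh x i)" for j
  have h: "h (prod_encode (x, i)) = hh x i" for x i
    by (simp add: h_def)
  \<comment> \<open>Variable 0 is the output, odd variables are branches, and the remaining even variables are
    the \<open>v x\<close>, which are eliminated one at a time.\<close>
  define w where "w l y = case_nat y (\<lambda>j. if even j then branch (h (j div 2)) l else v (j div 2) l)" for l y
  have w: "w l y 0 = y" "w l y (Suc (2 * x)) = branch (h x) l" "w l y (Suc (Suc (2 * x))) = v x l" for l y x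
    by (simp_all add: w_def)
  have eliminate: "\<exists>\<theta>'. wf_fm L \<theta>' \<and> (\<forall>x. Suc (Suc (2 * x)) \<notin> fv \<theta>') \<and>
      (\<forall>\<^sub>F l in sequentially. \<forall>y\<in>Dom (M l). sat (M l) (w l y) \<theta> \<longleftrightarrow> sat (M l) (w l y) \<theta>')"
    if "finite F" "wf_fm L \<theta>" "\<And>x. Suc (Suc (2 * x)) \<in> fv \<theta> \<Longrightarrow> x \<in> F" for F \<theta>
    using that
  proof (induction F arbitrary: \<theta> rule: finite_induct)
    case empty
    then show ?case by (intro exI[of _ \<theta>]) auto
  next
    case (insert x F)
    define z where "z = Suc (Suc (2 * x))"
    define \<rho> where "\<rho> = case_nat z (\<lambda>i. Suc (2 * prod_encode (x, i)))"
    define \<theta>2 where "\<theta>2 = Ex z (And (ren \<rho> (\<psi> x)) \<theta>)"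
    have range_\<rho>: "Suc (Suc (2 * x')) \<notin> range \<rho> - {z}" for x'
    proof
      assume "Suc (Suc (2 * x')) \<in> range \<rho> - {z}"
      then obtain i where "Suc (Suc (2 * x')) = \<rho> i" "\<rho> i \<noteq> z"
        by auto
      then show False
        unfolding \<rho>_def by (cases i) (auto, presburger)
    qed
    have "x' \<in> F" if x': "Suc (Suc (2 * x')) \<in> fv \<theta>2" for x'
    proof -
      have "Suc (Suc (2 * x')) \<in> fv \<theta>" "x' \<noteq> x"
        using x' range_\<rho>[of x'] fv_ren[of \<rho> "\<psi> x"] unfolding \<theta>2_def z_def by auto
      then show ?thesis
        using insert.prems(2) by blast
    qed
    moreover have "wf_fm L \<theta>2"
      using insert.prems(1) \<psi>(1) by (simp add: \<theta>2_def)
    ultimately obtain \<theta>' where \<theta>': "wf_fm L \<theta>'" "\<forall>x. Suc (Suc (2 * x)) \<notin> fv \<theta>'"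
        "\<forall>\<^sub>F l in sequentially. \<forall>y\<in>Dom (M l). sat (M l) (w l y) \<theta>2 \<longleftrightarrow> sat (M l) (w l y) \<theta>'"
      using insert.IH[of \<theta>2] by blast
    have "\<forall>\<^sub>F l in sequentially. \<forall>y\<in>Dom (M l). sat (M l) (w l y) \<theta> \<longleftrightarrow> sat (M l) (w l y) \<theta>'"
      using \<psi>(2)[of x] \<theta>'(3)
    proof eventually_elim
      case (elim l)
      show ?case
      proof
        fix y assume y: "y \<in> Dom (M l)"
        have "(w l y)(z := a) \<circ> \<rho> = case_nat a (\<lambda>i. branch (hh x i) l)" for a
        proof
          fix j show "((w l y)(z := a) \<circ> \<rho>) j = case_nat a (\<lambda>i. branch (hh x i) l) j"
            using w(2)[of l y "prod_encode (x, j - 1)"] h[of x "j - 1"]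
            by (cases j) (auto simp: \<rho>_def z_def, presburger)
        qed
        then have "sat (M l) (w l y) \<theta>2 \<longleftrightarrow> (\<exists>a\<in>Dom (M l). a = v x l \<and> sat (M l) ((w l y)(z := a)) \<theta>)"
          using elim(1) unfolding \<theta>2_def by (simp only: sat.simps sat_ren) blast
        also have "(w l y)(z := v x l) = w l y"
          using w(3)[of l y x] unfolding z_def by (metis fun_upd_triv)
        then have "(\<exists>a\<in>Dom (M l). a = v x l \<and> sat (M l) ((w l y)(z := a)) \<theta>) \<longleftrightarrow> sat (M l) (w l y) \<theta>"
          using definable_Dom[OF assms(2)[of x], of l] by auto
        finally show "sat (M l) (w l y) \<theta> \<longleftrightarrow> sat (M l) (w l y) \<theta>'"
          using elim(2) y by blast
      qed
    qed
    then show ?case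
      using \<theta>'(1,2) by blast
  qed
  define \<rho>0 where "\<rho>0 = case_nat 0 (\<lambda>i. Suc (Suc (2 * i)))"
  \<comment> \<open>Only variable 0 and odd variables remain after elimination, so halving the index
    restores the format of \<open>defined_by\<close>.\<close>
  define \<rho>1 where "\<rho>1 = case_nat 0 (\<lambda>j. Suc (j div 2))"
  have "finite {x. Suc (Suc (2 * x)) \<in> fv (ren \<rho>0 \<theta>)}"
    by (rule finite_subset[OF _ finite_vimageI[OF finite_fv[of "ren \<rho>0 \<theta>"], of "\<lambda>x. Suc (Suc (2 * x))"]])
      (auto simp: inj_on_def)
  then obtain \<theta>' where \<theta>': "wf_fm L \<theta>'" "\<forall>x. Suc (Suc (2 * x)) \<notin> fv \<theta>'"
      "\<forall>\<^sub>F l in sequentially. \<forall>y\<in>Dom (M l). sat (M l) (w l y) (ren \<rho>0 \<theta>) \<longleftrightarrow> sat (M l) (w l y) \<theta>'"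
    using eliminate[of _ "ren \<rho>0 \<theta>"] assms(1) by auto
  have "w l y \<circ> \<rho>0 = case_nat y (\<lambda>i. v i l)" for l y
    by (rule ext) (simp add: \<rho>0_def w split: nat.split)
  moreover have "sat (M l) (w l y) \<theta>' \<longleftrightarrow> sat (M l) (case_nat y (\<lambda>i. branch (h i) l) \<circ> \<rho>1) \<theta>'" for l y
  proof (rule sat_cong)
    fix i assume i: "i \<in> fv \<theta>'"
    show "w l y i = (case_nat y (\<lambda>i. branch (h i) l) \<circ> \<rho>1) i"
    proof (cases i)
      case (Suc j)
      have "even j"
        using i \<theta>'(2) unfolding Suc by (metis oddE Suc_eq_plus1)
      then show ?thesis
        unfolding Suc by (simp add: w_def \<rho>1_def)
    qed (simp add: w_def \<rho>1_def)
  qed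
  ultimately show thesis
    using \<theta>'(1,3) by (intro that[of "ren \<rho>1 \<theta>'" h]) (simp_all only: wf_ren sat_ren)
qed

lemma definableI:
  assumes "wf_fm L \<theta>" "\<And>i. definable (v i)" "\<And>l. g l \<in> Dom (M l)"
    "\<And>l y. y \<in> Dom (M l) \<Longrightarrow> sat (M l) (case_nat y (\<lambda>i. v i l)) \<theta> \<longleftrightarrow> y = g l"
  shows "definable g"
proof -
  obtain \<theta>' h where \<theta>': "wf_fm L \<theta>'" "\<forall>\<^sub>F l in sequentially. \<forall>y\<in>Dom (M l).
      sat (M l) (case_nat y (\<lambda>i. v i l)) \<theta> \<longleftrightarrow> sat (M l) (case_nat y (\<lambda>i. branch (h i) l)) \<theta>'"
    using definable_compose[OF assms(1,2)] .
  have "\<forall>\<^sub>F l in sequentially. \<forall>y\<in>Dom (M l).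
      sat (M l) (case_nat y (\<lambda>i. branch (h i) l)) \<theta>' \<longleftrightarrow> y = g l"
    using \<theta>'(2) by (rule eventually_mono) (simp add: assms(4))
  then show ?thesis
    using \<theta>'(1) assms(3) unfolding definable_def defined_by_def by blast
qed

lemma definable_branch: "definable (branch \<eta>)"
  unfolding definable_def defined_by_def
  by (intro conjI allI branch_Dom exI[of _ "Eq (Var 0) (Var 1)"] exI[of _ "\<lambda>_. \<eta>"]) simp_all

lemma definable_eval:
  assumes "wf_trm L t" "\<And>i. definable (v i)"
  shows "definable (\<lambda>l. eval_trm (M l) (\<lambda>i. v i l) t)"
proof (rule definableI)
  show "wf_fm L (Eq (Var 0) (ren_trm Suc t))"
    using assms(1) by (simp add: wf_ren_trm)
  show "definable (v i)" for i
    by (rule assms(2))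
  show "eval_trm (M l) (\<lambda>i. v i l) t \<in> Dom (M l)" for l
    by (rule eval_trm_in_Dom[OF structure_M assms(1)]) (use definable_Dom[OF assms(2)] in auto)
  have "case_nat y (\<lambda>i. v i l) \<circ> Suc = (\<lambda>i. v i l)" for y l
    by auto
  then show "sat (M l) (case_nat y (\<lambda>i. v i l)) (Eq (Var 0) (ren_trm Suc t)) \<longleftrightarrow>
      y = eval_trm (M l) (\<lambda>i. v i l) t" for y l
    by (simp only: sat.simps eval_trm.simps eval_ren_trm nat.case)
qed

lemma definable_decided:
  assumes "wf_fm L \<theta>" "\<And>i. definable (v i)"
  shows "(\<forall>\<^sub>F l in sequentially. sat (M l) (\<lambda>i. v i l) \<theta>) \<or>
    (\<forall>\<^sub>F l in sequentially. \<not> sat (M l) (\<lambda>i. v i l) \<theta>)"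
proof -
  obtain \<theta>' h where \<theta>': "wf_fm L \<theta>'" "\<forall>\<^sub>F l in sequentially. \<forall>y\<in>Dom (M l).
      sat (M l) (case_nat y (\<lambda>i. v i l)) (ren Suc \<theta>) \<longleftrightarrow> sat (M l) (case_nat y (\<lambda>i. branch (h i) l)) \<theta>'"
    using definable_compose[of "ren Suc \<theta>" v] assms by auto
  \<comment> \<open>The value variable is absent from \<open>ren Suc \<theta>\<close>, so the
    equivalence may be instantiated there with any element; a fixed branch is used.\<close>
  let ?h = "case_nat (\<lambda>_. True) h"
  have "case_nat (branch (\<lambda>_. True) l) (\<lambda>i. branch (h i) l) = (\<lambda>i. branch (?h i) l)" for l
    by (auto split: nat.split)
  moreover have "case_nat y (\<lambda>i. v i l) \<circ> Suc = (\<lambda>i. v i l)" for y l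
    by auto
  ultimately have ev: "\<forall>\<^sub>F l in sequentially.
      sat (M l) (\<lambda>i. v i l) \<theta> \<longleftrightarrow> sat (M l) (\<lambda>i. branch (?h i) l) \<theta>'"
    using \<theta>'(2) by (elim eventually_mono) (metis branch_Dom sat_ren)
  have "(\<forall>\<^sub>F l in sequentially. sat (M l) (\<lambda>i. v i l) \<theta>) \<longleftrightarrow>
      (\<forall>\<^sub>F l in sequentially. sat (M l) (\<lambda>i. branch (?h i) l) \<theta>')"
    using ev by (rule eventually_cong) auto
  moreover have "(\<forall>\<^sub>F l in sequentially. \<not> sat (M l) (\<lambda>i. v i l) \<theta>) \<longleftrightarrow>
      (\<forall>\<^sub>F l in sequentially. \<not> sat (M l) (\<lambda>i. branch (?h i) l) \<theta>')"
    using ev by (rule eventually_cong) auto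
  ultimately show ?thesis
    using branch_decided[OF \<theta>'(1), of ?h] by simp
qed

section \<open>Counting definable functions\<close>

lemma defined_by_unique:
  assumes "defined_by \<psi> h g" "defined_by \<psi> h g'" "definable g"
  shows "\<forall>\<^sub>F l in sequentially. g l = g' l"
proof -
  have "\<forall>\<^sub>F l in sequentially. \<forall>y\<in>Dom (M l).
        sat (M l) (case_nat y (\<lambda>i. branch (h i) l)) \<psi> \<longleftrightarrow> y = g l"
    "\<forall>\<^sub>F l in sequentially. \<forall>y\<in>Dom (M l).
        sat (M l) (case_nat y (\<lambda>i. branch (h i) l)) \<psi> \<longleftrightarrow> y = g' l"
    using assms(1,2) unfolding defined_by_def by blast+
  then show ?thesis
  proof eventually_elim
    case (elim l)
    then show ?case using definable_Dom[OF assms(3), of l] by simp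
  qed
qed

text \<open>The class of a definable function is determined by a defining formula and its sequence
  of branches. There are countably many formulas and continuum many such sequences, so the classes
  inject into \<open>nat \<Rightarrow> bool\<close> and from there into \<open>'u\<close>, where the
  limit has to live.\<close>

lemma ex_quotient_map:
  "\<exists>e :: (nat \<Rightarrow> 'u) \<Rightarrow> 'u. range e \<lesssim> (UNIV :: (nat \<Rightarrow> bool) set) \<and>
     (\<forall>g g'. definable g \<longrightarrow> definable g' \<longrightarrow> (e g = e g' \<longleftrightarrow> (\<forall>\<^sub>F l in sequentially. g l = g' l)))"
proof -
  obtain J :: "(nat \<Rightarrow> bool) \<Rightarrow> 'u" where J: "inj J"
    using universe unfolding lepoll_def by blast
  define cls where "cls g = {g'. definable g' \<and> (\<forall>\<^sub>F l in sequentially. g l = g' l)}" for g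
  have self: "g \<in> cls g" if "definable g" for g
    using that by (simp add: cls_def)
  have cls_eq: "cls g = cls g' \<longleftrightarrow> (\<forall>\<^sub>F l in sequentially. g l = g' l)"
    if "definable g" "definable g'" for g g'
  proof
    assume "cls g = cls g'"
    then have "g' \<in> cls g"
      using self[OF that(2)] by simp
    then show "\<forall>\<^sub>F l in sequentially. g l = g' l"
      by (simp add: cls_def)
  next
    assume ev: "\<forall>\<^sub>F l in sequentially. g l = g' l"
    have "(\<forall>\<^sub>F l in sequentially. g l = k l) \<longleftrightarrow> (\<forall>\<^sub>F l in sequentially. g' l = k l)" for k
      using ev by (rule eventually_cong) auto
    then show "cls g = cls g'"
      unfolding cls_def by simp
  qed
  have "\<forall>q. \<exists>p. q \<in> cls ` Collect definable \<longrightarrow>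
      (\<exists>g. definable g \<and> cls g = q \<and> defined_by (fst p) (snd p) g)"
  proof
    fix q
    show "\<exists>p. q \<in> cls ` Collect definable \<longrightarrow>
      (\<exists>g. definable g \<and> cls g = q \<and> defined_by (fst p) (snd p) g)"
    proof (cases "q \<in> cls ` Collect definable")
      case True
      then obtain g \<psi> h where "definable g" "cls g = q" "defined_by \<psi> h g"
        unfolding definable_def by blast
      then show ?thesis by (intro exI[of _ "(\<psi>, h)"]) auto
    qed blast
  qed
  then obtain pr where pr: "\<And>q. q \<in> cls ` Collect definable \<Longrightarrow>
      \<exists>g. definable g \<and> cls g = q \<and> defined_by (fst (pr q)) (snd (pr q)) g"
    by metis
  have inj_pr: "inj_on pr (cls ` Collect definable)"
  proof (rule inj_onI)
    fix q q' assume q: "q \<in> cls ` Collect definable" "q' \<in> cls ` Collect definable" "pr q = pr q'"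
    then show "q = q'"
      using pr[OF q(1)] pr[OF q(2)] defined_by_unique cls_eq by metis
  qed
  have wf_pr: "wf_fm L (fst (pr q))" if "q \<in> cls ` Collect definable" for q
    using pr[OF that] unfolding defined_by_def by blast
  \<comment> \<open>A number and a sequence of branches are coded as one branch: row 0 is the
    indicator of the number, row \<open>a + 1\<close> is branch \<open>a\<close>.\<close>
  define F :: "nat \<times> (nat \<Rightarrow> nat \<Rightarrow> bool) \<Rightarrow> nat \<Rightarrow> bool" where
    "F p j = (case prod_decode j of (0, i) \<Rightarrow> i = fst p | (Suc a, i) \<Rightarrow> snd p a i)" for p j
  have F: "F p (prod_encode (0, i)) \<longleftrightarrow> i = fst p" "F p (prod_encode (Suc a, i)) = snd p a i" for p i a
    by (simp_all add: F_def)
  have "inj F"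
  proof (rule injI, rule prod_eqI)
    fix p q assume "F p = F q"
    then have F': "F p j = F q j" for j
      by simp
    show "fst p = fst q"
      using F'[of "prod_encode (0, fst p)"] by (simp add: F)
    show "snd p = snd q"
      using F'[of "prod_encode (Suc a, i)" for a i] by (intro ext) (simp add: F)
  qed
  define G where "G p = F (to_nat_on {\<psi>. wf_fm L \<psi>} (fst p), snd p)" for p
  have inj_G: "inj_on G (Collect (wf_fm L) \<times> UNIV)"
  proof (rule inj_onI)
    fix p q :: "('f, 'r) fm \<times> (nat \<Rightarrow> nat \<Rightarrow> bool)"
    assume p: "p \<in> Collect (wf_fm L) \<times> UNIV" "q \<in> Collect (wf_fm L) \<times> UNIV" "G p = G q"
    then have "to_nat_on {\<psi>. wf_fm L \<psi>} (fst p) = to_nat_on {\<psi>. wf_fm L \<psi>} (fst q)" "snd p = snd q"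
      using injD[OF \<open>inj F\<close>] unfolding G_def by blast+
    then show "p = q"
      using p inj_on_to_nat_on[OF countable_wf_fm[OF countable_L]]
      by (auto simp: prod_eq_iff mem_Times_iff dest: inj_onD)
  qed
  define e where "e g = J (G (pr (cls g)))" for g
  have "e g = e g' \<longleftrightarrow> (\<forall>\<^sub>F l in sequentially. g l = g' l)" if "definable g" "definable g'" for g g'
  proof -
    have mem: "cls g \<in> cls ` Collect definable" "cls g' \<in> cls ` Collect definable"
      using that by auto
    then have "pr (cls g) \<in> Collect (wf_fm L) \<times> UNIV" "pr (cls g') \<in> Collect (wf_fm L) \<times> UNIV"
      using wf_pr by (auto simp: mem_Times_iff)
    then have "e g = e g' \<longleftrightarrow> pr (cls g) = pr (cls g')"
      unfolding e_def using J inj_G by (metis inj_eq inj_on_eq_iff)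
    then show ?thesis
      using inj_pr mem cls_eq[OF that] by (metis inj_on_eq_iff)
  qed
  moreover have "range e \<lesssim> (UNIV :: (nat \<Rightarrow> bool) set)"
    by (rule lepoll_trans[OF subset_imp_lepoll image_lepoll]) (auto simp: e_def)
  ultimately show ?thesis by blast
qed

end


section \<open>The limit structure\<close>

text \<open>\<open>e\<close> names classes of definable functions by elements of the universe;
  elsewhere only the size of its range is constrained. The types \<open>'a\<close>,
  \<open>'b\<close>, \<open>'c\<close> are \<open>'f\<close>, \<open>'r\<close>, \<open>'u\<close>
  of the parent locale.\<close>

locale limit_structure = branching_models +
  fixes e :: "(nat \<Rightarrow> 'c) \<Rightarrow> 'c"
  assumes range_e: "range e \<lesssim> (UNIV :: (nat \<Rightarrow> bool) set)"
    and e_eq: "definable g \<Longrightarrow> definable g' \<Longrightarrow> e g = e g' \<longleftrightarrow> (\<forall>\<^sub>F l in sequentially. g l = g' l)"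
begin

definition rep :: "'c \<Rightarrow> nat \<Rightarrow> 'c" where
  "rep x = (SOME g. definable g \<and> e g = x)"

definition N :: "('a, 'b, 'c) struct" where
  "N = \<lparr>Dom = e ` Collect definable,
     FunI = \<lambda>f xs. e (\<lambda>l. FunI (M l) f (map (\<lambda>x. rep x l) xs)),
     RelI = \<lambda>r xs. \<forall>\<^sub>F l in sequentially. RelI (M l) r (map (\<lambda>x. rep x l) xs)\<rparr>"

lemma Dom_N: "Dom N = e ` Collect definable"
  and FunI_N: "FunI N f xs = e (\<lambda>l. FunI (M l) f (map (\<lambda>x. rep x l) xs))"
  and RelI_N: "RelI N r xs \<longleftrightarrow> (\<forall>\<^sub>F l in sequentially. RelI (M l) r (map (\<lambda>x. rep x l) xs))"
  by (simp_all add: N_def)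

lemma rep:
  assumes "definable g"
  shows "definable (rep (e g))" "\<forall>\<^sub>F l in sequentially. rep (e g) l = g l"
proof -
  have "definable (rep (e g)) \<and> e (rep (e g)) = e g"
    unfolding rep_def by (rule someI[of _ g]) (simp add: assms)
  then show "definable (rep (e g))" "\<forall>\<^sub>F l in sequentially. rep (e g) l = g l"
    using e_eq assms by auto
qed

lemma eventually_map_rep:
  assumes "\<And>t. t \<in> set ts \<Longrightarrow> definable (G t)"
  shows "\<forall>\<^sub>F l in sequentially. map (\<lambda>x. rep x l) (map (\<lambda>t. e (G t)) ts) = map (\<lambda>t. G t l) ts"
proof -
  have "\<forall>\<^sub>F l in sequentially. \<forall>t\<in>set ts. rep (e (G t)) l = G t l"
    by (intro eventually_ball_finite ballI rep(2) assms) auto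
  then show ?thesis
    by (rule eventually_mono) simp
qed

lemma eval_N:
  assumes "wf_trm L t" "\<And>i. definable (v i)"
  shows "eval_trm N (\<lambda>i. e (v i)) t = e (\<lambda>l. eval_trm (M l) (\<lambda>i. v i l) t)"
  using assms(1)
proof (induction t)
  case (Fn f ts)
  let ?G = "\<lambda>t l. eval_trm (M l) (\<lambda>i. v i l) t"
  \<comment> \<open>\<open>?g\<close> is computed from chosen representatives and agrees with the
    pointwise value only eventually; \<open>definable_cong\<close> makes it definable
    nonetheless.\<close>
  let ?g = "\<lambda>l. FunI (M l) f (map (\<lambda>x. rep x l) (map (\<lambda>t. e (?G t)) ts))"
  have def_G: "definable (?G t)" if "t \<in> set ts" for t
    using Fn.prems that by (intro definable_eval assms(2)) auto
  have "map (eval_trm N (\<lambda>i. e (v i))) ts = map (\<lambda>t. e (?G t)) ts"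
    using Fn by (intro map_cong) auto
  then have 1: "eval_trm N (\<lambda>i. e (v i)) (Fn f ts) = e ?g"
    by (simp only: eval_trm.simps FunI_N)
  have ev: "\<forall>\<^sub>F l in sequentially. ?g l = ?G (Fn f ts) l"
  proof -
    have "?G (Fn f ts) l = FunI (M l) f (map (\<lambda>t. ?G t l) ts)" for l
      by simp
    moreover have "\<forall>\<^sub>F l in sequentially.
        map (\<lambda>x. rep x l) (map (\<lambda>t. e (?G t)) ts) = map (\<lambda>t. ?G t l) ts"
      by (rule eventually_map_rep) (rule def_G)
    ultimately show ?thesis
      by (elim eventually_mono) presburger
  qed
  have def: "definable (?G (Fn f ts))"
    by (intro definable_eval assms(2)) (fact Fn.prems)
  have "?g l \<in> Dom (M l)" for l
  proof -
    have "set (map (\<lambda>x. rep x l) (map (\<lambda>t. e (?G t)) ts)) \<subseteq> Dom (M l)"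
      using definable_Dom[OF rep(1)[OF def_G]] by auto
    then show ?thesis
      using structure_M[of l] Fn.prems unfolding is_structure_def by fastforce
  qed
  then have "definable ?g"
    using definable_cong[OF def ev] by blast
  then show ?case
    unfolding 1 using e_eq def ev by blast
qed simp

lemma fun_upd_e: "(\<lambda>i. e (v i))(x := e g) = (\<lambda>i. e ((v(x := g)) i))"
  by auto

lemma sat_N:
  assumes "wf_fm L \<theta>" "\<And>i. definable (v i)"
  shows "sat N (\<lambda>i. e (v i)) \<theta> \<longleftrightarrow> (\<forall>\<^sub>F l in sequentially. sat (M l) (\<lambda>i. v i l) \<theta>)"
  using assms
proof (induction \<theta> arbitrary: v)
  case Bot
  then show ?case by simp
next
  case (Eq s t)
  then show ?case
    by (simp add: eval_N definable_eval e_eq)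
next
  case (Rel r ts)
  let ?G = "\<lambda>t l. eval_trm (M l) (\<lambda>i. v i l) t"
  have "map (eval_trm N (\<lambda>i. e (v i))) ts = map (\<lambda>t. e (?G t)) ts"
    using Rel by (intro map_cong) (auto simp: eval_N)
  then have "sat N (\<lambda>i. e (v i)) (Rel r ts) \<longleftrightarrow>
      (\<forall>\<^sub>F l in sequentially. RelI (M l) r (map (\<lambda>x. rep x l) (map (\<lambda>t. e (?G t)) ts)))"
    by (simp only: sat.simps RelI_N)
  also have "\<dots> \<longleftrightarrow> (\<forall>\<^sub>F l in sequentially. RelI (M l) r (map (\<lambda>t. ?G t l) ts))"
  proof (rule eventually_cong[OF eventually_map_rep])
    show "definable (?G t)" if "t \<in> set ts" for t
      using Rel that by (intro definable_eval) auto
  qed (erule arg_cong)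
  finally show ?case
    by simp
next
  case (Neg \<theta>)
  have "(\<forall>\<^sub>F l in sequentially. \<not> sat (M l) (\<lambda>i. v i l) \<theta>) \<longleftrightarrow>
      \<not> (\<forall>\<^sub>F l in sequentially. sat (M l) (\<lambda>i. v i l) \<theta>)"
    using definable_decided[of \<theta> v] Neg.prems
      eventually_conj[of "\<lambda>l. sat (M l) (\<lambda>i. v i l) \<theta>" sequentially "\<lambda>l. \<not> sat (M l) (\<lambda>i. v i l) \<theta>"]
    by auto
  then show ?case
    using Neg by simp
next
  case (And \<theta>1 \<theta>2)
  then show ?case
    by (simp add: eventually_conj_iff)
next
  case (Ex x \<theta>)
  have def_upd: "definable ((v(x := g)) i)" if "definable g" for g i
    using Ex.prems that by simp
  have upd: "(\<lambda>i. (v(x := g)) i l) = (\<lambda>i. v i l)(x := g l)" for g l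
    by auto
  have IH: "sat N ((\<lambda>i. e (v i))(x := e g)) \<theta> \<longleftrightarrow>
      (\<forall>\<^sub>F l in sequentially. sat (M l) ((\<lambda>i. v i l)(x := g l)) \<theta>)" if "definable g" for g
    using Ex.IH[of "v(x := g)"] Ex.prems(1) def_upd[OF that] by (simp only: fun_upd_e upd wf_fm.simps)
  show ?case
  proof
    assume "sat N (\<lambda>i. e (v i)) (Ex x \<theta>)"
    then obtain g where g: "definable g" "sat N ((\<lambda>i. e (v i))(x := e g)) \<theta>"
      by (auto simp: Dom_N)
    then have "\<forall>\<^sub>F l in sequentially. sat (M l) ((\<lambda>i. v i l)(x := g l)) \<theta>"
      using IH by blast
    then show "\<forall>\<^sub>F l in sequentially. sat (M l) (\<lambda>i. v i l) (Ex x \<theta>)"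
      by (rule eventually_mono) (use definable_Dom[OF g(1)] in auto)
  next
    assume ex: "\<forall>\<^sub>F l in sequentially. sat (M l) (\<lambda>i. v i l) (Ex x \<theta>)"
    have "wf_fm L \<theta>"
      using Ex.prems(1) by simp
    then obtain \<psi> where \<psi>: "wf_fm L \<psi>"
        "\<And>l v. range v \<subseteq> Dom (M l) \<Longrightarrow> \<exists>!b. b \<in> Dom (M l) \<and> sat (M l) (v(x := b)) \<psi>"
        "\<And>l v b. range v \<subseteq> Dom (M l) \<Longrightarrow> sat (M l) v (Ex x \<theta>) \<Longrightarrow> b \<in> Dom (M l) \<Longrightarrow>
          sat (M l) (v(x := b)) \<psi> \<Longrightarrow> sat (M l) (v(x := b)) \<theta>"
      using skolem models_M unfolding has_definable_Skolem_functions_def by metis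
    have range: "range (\<lambda>i. v i l) \<subseteq> Dom (M l)" for l
      using definable_Dom Ex.prems(2) by auto
    \<comment> \<open>Witnesses picked separately in each \<open>M l\<close> need not form a
      definable function; those given by the single formula \<psi> do.\<close>
    define g where "g l = (THE b. b \<in> Dom (M l) \<and> sat (M l) ((\<lambda>i. v i l)(x := b)) \<psi>)" for l
    have g: "g l \<in> Dom (M l)" "sat (M l) ((\<lambda>i. v i l)(x := g l)) \<psi>" for l
      using theI'[OF \<psi>(2)[OF range[of l]]] unfolding g_def by auto
    have "definable g"
    proof (rule definableI)
      \<comment> \<open>The Skolem formula has its value in variable \<open>x\<close>, whereas
        \<open>definableI\<close> expects it in variable 0 and \<open>v i\<close> in variable
        \<open>i + 1\<close>.\<close>
      let ?\<rho> = "\<lambda>i. if i = x then 0 else Suc i"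
      show "wf_fm L (ren ?\<rho> \<psi>)" "definable (v i)" "g l \<in> Dom (M l)" for i l
        using \<psi>(1) Ex.prems(2) g(1) by auto
      fix l y assume y: "y \<in> Dom (M l)"
      have "case_nat y (\<lambda>i. v i l) \<circ> ?\<rho> = (\<lambda>i. v i l)(x := y)"
        by auto
      then show "sat (M l) (case_nat y (\<lambda>i. v i l)) (ren ?\<rho> \<psi>) \<longleftrightarrow> y = g l"
        using \<psi>(2)[OF range[of l]] g[of l] y by (simp only: sat_ren) blast
    qed
    moreover have "\<forall>\<^sub>F l in sequentially. sat (M l) ((\<lambda>i. v i l)(x := g l)) \<theta>"
      using ex by (rule eventually_mono) (use \<psi>(3)[OF range _ g] in blast)
    ultimately show "sat N (\<lambda>i. e (v i)) (Ex x \<theta>)"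
      using IH by (auto simp: Dom_N)
  qed
qed

lemma ex_valuation:
  assumes "range v \<subseteq> Dom N"
  shows "\<exists>w. (\<forall>i. definable (w i)) \<and> v = (\<lambda>i. e (w i))"
proof -
  have "\<forall>i. \<exists>g. definable g \<and> v i = e g"
    using assms unfolding Dom_N by blast
  then show ?thesis
    unfolding fun_eq_iff by metis
qed

section \<open>The limit as a model omitting the type\<close>

lemma models_N: "models L N T"
proof -
  have "Dom N \<noteq> {}"
    using definable_branch by (auto simp: Dom_N)
  moreover have "FunI N f xs \<in> Dom N" if f: "(f, length xs) \<in> Funs L" "set xs \<subseteq> Dom N" for f xs
  proof -
    \<comment> \<open>Arguments become values of variables, padded by an arbitrary element, so that
      closure under \<open>f\<close> reduces to definability of a term.\<close>
    define v where "v i = (if i < length xs then xs ! i else e (branch (\<lambda>_. True)))" for i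
    have "range v \<subseteq> Dom N"
      using f(2) definable_branch by (auto simp: v_def Dom_N)
    then obtain w where w: "\<And>i. definable (w i)" "v = (\<lambda>i. e (w i))"
      using ex_valuation by blast
    let ?t = "Fn f (map Var [0..<length xs])"
    have wf: "wf_trm L ?t"
      using f(1) by simp
    have "map (eval_trm N v) (map Var [0..<length xs]) = xs"
      by (rule nth_equalityI) (auto simp: v_def)
    then have "FunI N f xs = eval_trm N v ?t"
      by (simp only: eval_trm.simps)
    also have "\<dots> = e (\<lambda>l. eval_trm (M l) (\<lambda>i. w i l) ?t)"
      unfolding w(2) by (rule eval_N[OF wf w(1)])
    finally show ?thesis
      using definable_eval[OF wf, of w] w(1) by (simp only: Dom_N) blast
  qed
  moreover have "sat N v \<phi>" if \<phi>: "\<phi> \<in> T" "range v \<subseteq> Dom N" for \<phi> v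
  proof -
    obtain w where w: "\<And>i. definable (w i)" "v = (\<lambda>i. e (w i))"
      using ex_valuation[OF \<phi>(2)] by blast
    have "sat (M l) (\<lambda>i. w i l) \<phi>" for l
    proof -
      have "range (\<lambda>i. w i l) \<subseteq> Dom (M l)"
        using definable_Dom w(1) by auto
      then show ?thesis
        using models_M \<phi>(1) unfolding models_def by blast
    qed
    then show ?thesis
      unfolding w(2) using sat_N w(1) theory_T \<phi>(1) unfolding is_theory_def by simp
  qed
  ultimately show ?thesis
    unfolding models_def is_structure_def by auto
qed

text \<open>An element of \<open>N\<close> comes from a formula \<psi> whose only solution is
  eventually \<open>g l\<close>. The covering for \<psi> cannot report that there is no solution, so
  it yields one \<delta> eventually refuted by \<open>g l\<close>, contrary to
  \<open>sat_N\<close>.\<close>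

lemma omits_N: "omits N \<Delta>"
  unfolding omits_def
proof
  assume "\<exists>a\<in>Dom N. \<forall>\<delta>\<in>\<Delta>. sat N (\<lambda>_. a) \<delta>"
  then obtain g where g: "definable g" "\<And>\<delta>. \<delta> \<in> \<Delta> \<Longrightarrow> sat N (\<lambda>_. e g) \<delta>"
    unfolding Dom_N by blast
  obtain \<psi> h where \<psi>: "wf_fm L \<psi>" "\<forall>\<^sub>F l in sequentially. \<forall>y\<in>Dom (M l).
      sat (M l) (case_nat y (\<lambda>i. branch (h i) l)) \<psi> \<longleftrightarrow> y = g l"
    using g(1) unfolding definable_def defined_by_def by blast
  \<comment> \<open>Variable 0 is bound in the formulas of \<open>branch_omits\<close>, so the entry
    in front of the shifted \<open>h\<close> is arbitrary.\<close>
  let ?h = "case_nat (h 0) h"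
  have upd: "(\<lambda>i. branch (?h i) l)(0 := y) = case_nat y (\<lambda>i. branch (h i) l)" for l y
    by (auto split: nat.split)
  show False
  proof (rule disjE[OF branch_omits[OF \<psi>(1), of ?h]])
    assume "\<forall>\<^sub>F l in sequentially. sat (M l) (\<lambda>i. branch (?h i) l) (Neg (Ex 0 \<psi>))"
    with \<psi>(2) have "\<forall>\<^sub>F l in sequentially. False"
      by eventually_elim (simp only: sat.simps upd, use definable_Dom[OF g(1)] in blast)
    then show False by simp
  next
    assume "\<exists>\<delta>\<in>\<Delta>. \<forall>\<^sub>F l in sequentially. sat (M l) (\<lambda>i. branch (?h i) l) (Ex 0 (And \<psi> (Neg \<delta>)))"
    then obtain \<delta> where \<delta>: "\<delta> \<in> \<Delta>"
        "\<forall>\<^sub>F l in sequentially. sat (M l) (\<lambda>i. branch (?h i) l) (Ex 0 (And \<psi> (Neg \<delta>)))"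
      by blast
    have wf: "wf_fm L \<delta>" "fv \<delta> \<subseteq> {0}"
      using type_\<Delta> \<delta>(1) unfolding is_partial_1type_def by auto
    have "\<forall>\<^sub>F l in sequentially. sat (M l) (\<lambda>_. g l) \<delta>"
      using sat_N[OF wf(1), of "\<lambda>_. g"] g \<delta>(1) by simp
    with \<psi>(2) \<delta>(2) have "\<forall>\<^sub>F l in sequentially. False"
    proof eventually_elim
      case (elim l)
      obtain y where y: "y \<in> Dom (M l)" "sat (M l) (case_nat y (\<lambda>i. branch (h i) l)) \<psi>"
          "\<not> sat (M l) (case_nat y (\<lambda>i. branch (h i) l)) \<delta>"
        using elim(2) by (simp only: sat.simps upd) blast
      then have "y = g l"
        using elim(1) by blast
      have "sat (M l) (case_nat y (\<lambda>i. branch (h i) l)) \<delta> \<longleftrightarrow> sat (M l) (\<lambda>_. g l) \<delta>"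
        by (rule sat_cong) (use wf(2) \<open>y = g l\<close> in auto)
      then show ?case
        using y(3) elim(3) by blast
    qed
    then show False by simp
  qed
qed

section \<open>The asymptotically similar set\<close>

definition c :: "(nat \<Rightarrow> bool) \<Rightarrow> 'c" where
  "c \<eta> = e (branch \<eta>)"

lemma inj_c: "inj c"
proof (rule injI, rule ccontr)
  fix \<eta> \<tau> assume eq: "c \<eta> = c \<tau>" and "\<eta> \<noteq> \<tau>"
  have "\<forall>\<^sub>F l in sequentially. branch \<eta> l = branch \<tau> l"
    using eq e_eq definable_branch unfolding c_def by blast
  with branch_neq[OF \<open>\<eta> \<noteq> \<tau>\<close>] have "\<forall>\<^sub>F l in sequentially. False"
    by eventually_elim simp
  then show False by simp
qed

lemma asymptotically_similar_c: "asymptotically_similar L N c"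
  unfolding asymptotically_similar_def
proof (intro conjI allI impI inj_c)
  show "range c \<subseteq> Dom N"
    using definable_branch by (auto simp: c_def Dom_N)
  fix k \<theta> assume \<theta>: "wf_fm L \<theta> \<and> fv \<theta> \<subseteq> {..<k}"
  have sat_c: "sat N ((!) (map c \<eta>s)) \<theta> \<longleftrightarrow>
      (\<forall>\<^sub>F j in sequentially. sat (M j) (\<lambda>i. branch (\<eta>s ! i) j) \<theta>)"
    if "length \<eta>s = k" for \<eta>s
  proof -
    have "sat N ((!) (map c \<eta>s)) \<theta> \<longleftrightarrow> sat N (\<lambda>i. e (branch (\<eta>s ! i))) \<theta>"
      by (rule sat_cong) (use \<theta> that in \<open>auto simp: c_def\<close>)
    then show ?thesis
      using sat_N \<theta> definable_branch by simp
  qed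
  obtain n where "\<forall>l\<ge>n. \<forall>\<eta>s \<tau>s. length \<eta>s = k \<longrightarrow> similar_mod l \<eta>s \<tau>s \<longrightarrow>
        ((\<forall>\<^sub>F j in sequentially. sat (M j) (\<lambda>i. branch (\<eta>s ! i) j) \<theta>) \<longleftrightarrow>
         (\<forall>\<^sub>F j in sequentially. sat (M j) (\<lambda>i. branch (\<tau>s ! i) j) \<theta>))"
    using branch_similar \<theta> by blast
  then show "\<exists>n. \<forall>l\<ge>n. \<forall>\<eta>s \<tau>s. length \<eta>s = k \<and> length \<tau>s = k \<and> similar_mod l \<eta>s \<tau>s \<longrightarrow>
      sat N ((!) (map c \<eta>s)) \<theta> = sat N ((!) (map c \<tau>s)) \<theta>"
    using sat_c by (intro exI[of _ n]) blast
qed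

lemma Dom_N_eqpoll: "Dom N \<approx> (UNIV :: (nat \<Rightarrow> bool) set)"
proof (rule lepoll_antisym)
  show "Dom N \<lesssim> (UNIV :: (nat \<Rightarrow> bool) set)"
    by (rule lepoll_trans[OF subset_imp_lepoll range_e]) (auto simp: Dom_N)
  show "(UNIV :: (nat \<Rightarrow> bool) set) \<lesssim> Dom N"
    using asymptotically_similar_c unfolding asymptotically_similar_def lepoll_def by blast
qed

end


section \<open>The branches of a tree of models\<close>

text \<open>Least significant digit first, so that cutting a branch at length \<open>m\<close> is
  reduction modulo \<open>2 ^ m\<close>, as in the numbering of the nodes.\<close>

definition prefix_code :: "(nat \<Rightarrow> bool) \<Rightarrow> nat \<Rightarrow> nat" where
  "prefix_code \<eta> l = horner_sum of_bool 2 (restr \<eta> l)"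

lemma prefix_code_less: "prefix_code \<eta> l < 2 ^ l"
  using horner_sum_of_bool_2_less[of "restr \<eta> l"] by (simp add: prefix_code_def restr_def)

lemma prefix_code_mod: "m \<le> l \<Longrightarrow> prefix_code \<eta> l mod 2 ^ m = prefix_code \<eta> m"
  unfolding prefix_code_def restr_def take_bit_eq_mod[symmetric] take_bit_horner_sum_bit_eq
  by (simp add: take_map min_absorb1)

lemma prefix_code_eq_iff: "prefix_code \<eta> l = prefix_code \<tau> l \<longleftrightarrow> restr \<eta> l = restr \<tau> l"
proof
  assume eq: "prefix_code \<eta> l = prefix_code \<tau> l"
  show "restr \<eta> l = restr \<tau> l"
  proof (rule nth_equalityI)
    fix i assume "i < length (restr \<eta> l)"
    then show "restr \<eta> l ! i = restr \<tau> l ! i"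
      using arg_cong[OF eq, of "\<lambda>x. bit x i"] by (simp add: prefix_code_def bit_horner_sum_bit_iff restr_def)
  qed (simp add: restr_def)
qed (simp add: prefix_code_def)

lemma eventually_prefix_code_neq:
  assumes "\<eta> \<noteq> \<tau>"
  shows "\<forall>\<^sub>F l in sequentially. prefix_code \<eta> l \<noteq> prefix_code \<tau> l"
proof -
  obtain i where i: "\<eta> i \<noteq> \<tau> i"
    using assms by blast
  have "prefix_code \<eta> l \<noteq> prefix_code \<tau> l" if "Suc i \<le> l" for l
    using that i by (auto simp: prefix_code_eq_iff restr_def)
  then show ?thesis
    unfolding eventually_sequentially by blast
qed

context high_rank_models
begin

text \<open>The tree is built for two kinds of coverings, one for truth values and one for omission.
  A branch passes at level \<open>l\<close> through the node coding its first \<open>l\<close>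
  digits, so decisions about nodes become decisions about the branches through them.\<close>

lemma ex_branching_models:
  assumes cnt: "countable_lang L" and th: "is_theory L T" and ty: "is_partial_1type L \<Delta>"
    and sk: "has_definable_Skolem_functions U L T"
    and univ: "(UNIV :: (nat \<Rightarrow> bool) set) \<lesssim> (UNIV :: 'u set)"
  obtains M branch where "branching_models L T \<Delta> U M branch"
proof -
  define omit where "omit \<psi> = insert (Neg (Ex 0 \<psi>)) ((\<lambda>\<delta>. Ex 0 (And \<psi> (Neg \<delta>))) ` \<Delta>)" for \<psi>
  define tasks where "tasks =
    {(k, {\<theta>, Neg \<theta>}) |k \<theta>. wf_fm L \<theta> \<and> fv \<theta> \<subseteq> {..<k}} \<union>
    {(k, omit \<psi>) |k \<psi>. wf_fm L \<psi> \<and> fv \<psi> \<subseteq> {..<k}}"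
  have truth_task: "(k, {\<theta>, Neg \<theta>}) \<in> tasks" and omit_task: "(k, omit \<theta>) \<in> tasks"
    if "wf_fm L \<theta>" "fv \<theta> \<subseteq> {..<k}" for \<theta> k
    using that unfolding tasks_def by blast+
  have "tasks \<subseteq> (\<lambda>(k, \<theta>). (k, {\<theta>, Neg \<theta>})) ` (UNIV \<times> {\<theta>. wf_fm L \<theta>}) \<union>
      (\<lambda>(k, \<psi>). (k, omit \<psi>)) ` (UNIV \<times> {\<psi>. wf_fm L \<psi>})"
    unfolding tasks_def by auto
  then have cnt_tasks: "countable tasks"
    by (rule countable_subset)
      (intro countable_Un countable_image countable_SIGMA countable_wf_fm[OF cnt] countableI_type)
  have \<Delta>: "wf_fm L \<delta>" "fv \<delta> \<subseteq> {0}" if "\<delta> \<in> \<Delta>" for \<delta>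
    using ty that unfolding is_partial_1type_def by auto
  have "countable \<Delta>"
    by (rule countable_subset[OF _ countable_wf_fm[OF cnt]]) (use \<Delta> in auto)
  have covering_tasks: "covering k X" if task: "(k, X) \<in> tasks" for k X
  proof -
    consider \<theta> where "wf_fm L \<theta>" "fv \<theta> \<subseteq> {..<k}" "X = {\<theta>, Neg \<theta>}"
      | \<psi> where "wf_fm L \<psi>" "fv \<psi> \<subseteq> {..<k}" "X = omit \<psi>"
      using task unfolding tasks_def by auto
    then show ?thesis
    proof cases
      case 1
      then show ?thesis unfolding covering_def by auto
    next
      case (2 \<psi>)
      \<comment> \<open>Here omission becomes a covering: a solution of \<psi> in a model omitting
        \<Delta> refutes some \<delta>.\<close>
      have "\<exists>\<theta>\<in>X. sat M b \<theta>" if M: "model M" for M b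
      proof (cases "sat M b (Neg (Ex 0 \<psi>))")
        case True
        then show ?thesis unfolding 2(3) omit_def by blast
      next
        case False
        then obtain a where a: "a \<in> Dom M" "sat M (b(0 := a)) \<psi>"
          by auto
        then obtain \<delta> where \<delta>: "\<delta> \<in> \<Delta>" "\<not> sat M (\<lambda>_. a) \<delta>"
          using M unfolding model_def omits_def by blast
        have "sat M (b(0 := a)) \<delta> \<longleftrightarrow> sat M (\<lambda>_. a) \<delta>"
          by (rule sat_cong) (use \<Delta>[OF \<delta>(1)] in auto)
        then have "sat M b (Ex 0 (And \<psi> (Neg \<delta>)))"
          using a \<delta>(2) by auto
        then show ?thesis
          unfolding 2(3) omit_def using \<delta>(1) by blast
      qed
      moreover have "\<forall>\<theta>\<in>X. wf_fm L \<theta> \<and> fv \<theta> \<subseteq> {..<k}"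
        unfolding 2(3) omit_def using \<Delta> 2(1,2) by fastforce
      moreover have "countable X"
        unfolding 2(3) omit_def using \<open>countable \<Delta>\<close> by simp
      ultimately show ?thesis
        unfolding covering_def by blast
    qed
  qed
  \<comment> \<open>One task is exhibited so that the set is non-empty and
    \<open>from_nat_into\<close> enumerates exactly it.\<close>
  have "(0, {Bot, Neg Bot}) \<in> tasks"
    by (rule truth_task) auto
  then have range_task: "range (from_nat_into tasks) = tasks"
    using cnt_tasks by (intro range_from_nat_into) auto
  have cov: "covering (fst (from_nat_into tasks i)) (snd (from_nat_into tasks i))" for i
    using covering_tasks[of "fst (from_nat_into tasks i)" "snd (from_nat_into tasks i)"] range_task
    by (metis prod.collapse rangeI)
  show thesis
  proof (rule tree_of_models[of "from_nat_into tasks", OF cov])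
    fix M and b :: "nat \<Rightarrow> nat \<Rightarrow> 'u"
    assume M: "\<And>l. model (M l)" and b: "\<And>l. range (b l) \<subseteq> Dom (M l)" "\<And>l. inj_on (b l) {..<2 ^ l}"
      and tree: "\<And>i. \<exists>n. \<forall>m\<ge>n. \<forall>\<rho> :: nat \<Rightarrow> nat. (\<forall>j. \<rho> j < 2 ^ m) \<longrightarrow>
       (\<exists>\<theta>\<in>snd (from_nat_into tasks i). \<forall>l\<ge>m. \<forall>f :: nat \<Rightarrow> nat.
         (\<forall>j<2 ^ m. f j < 2 ^ l \<and> f j mod 2 ^ m = j) \<longrightarrow>
          sat (M l) (b l \<circ> f \<circ> \<rho>) \<theta>)"
    define branch where "branch \<eta> l = b l (prefix_code \<eta> l)" for \<eta> l
    \<comment> \<open>At such a level equal nodes mean equal branches, so a node determines which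
      branch to follow.\<close>
    define sep where "sep k h m \<longleftrightarrow>
      (\<forall>i<k. \<forall>j<k. h i \<noteq> h j \<longrightarrow> prefix_code (h i) m \<noteq> prefix_code (h j) m)" for k :: nat and h m
    have ev_sep: "\<forall>\<^sub>F m in sequentially. sep k h m" for k h
    proof -
      have "\<forall>\<^sub>F m in sequentially. \<forall>i\<in>{..<k}. \<forall>j\<in>{..<k}. h i \<noteq> h j \<longrightarrow> prefix_code (h i) m \<noteq> prefix_code (h j) m"
        by (intro eventually_ball_finite ballI finite_lessThan)
            (metis (mono_tags) eventually_prefix_code_neq eventually_mono always_eventually)
      then show ?thesis
        unfolding sep_def by (rule eventually_mono) auto
    qed
    \<comment> \<open>The order of quantifiers is essential: \<theta> is chosen from the nodes
      \<rho> before the branches \<open>h\<close> through them, so similar tuples receive the same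
      decision.\<close>
    have choose: "\<exists>n. \<forall>m\<ge>n. \<forall>\<rho>. (\<forall>j. \<rho> j < 2 ^ m) \<longrightarrow> (\<exists>\<theta>\<in>X. \<forall>h. sep k h m \<longrightarrow>
        (\<forall>i<k. prefix_code (h i) m = \<rho> i) \<longrightarrow> (\<forall>\<^sub>F l in sequentially. sat (M l) (\<lambda>i. branch (h i) l) \<theta>))"
      if task: "(k, X) \<in> tasks" for k X
    proof -
      obtain i where i: "from_nat_into tasks i = (k, X)"
        using task range_task by (metis imageE)
      obtain n where n: "\<forall>m\<ge>n. \<forall>\<rho> :: nat \<Rightarrow> nat. (\<forall>j. \<rho> j < 2 ^ m) \<longrightarrow>
          (\<exists>\<theta>\<in>X. \<forall>l\<ge>m. \<forall>f :: nat \<Rightarrow> nat.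
         (\<forall>j<2 ^ m. f j < 2 ^ l \<and> f j mod 2 ^ m = j) \<longrightarrow>
            sat (M l) (b l \<circ> f \<circ> \<rho>) \<theta>)"
        using tree[of i] unfolding i snd_conv by blast
      show ?thesis
      proof (intro exI[of _ n] allI impI)
        fix m and \<rho> :: "nat \<Rightarrow> nat"
        assume m: "n \<le> m" and \<rho>: "\<forall>j. \<rho> j < 2 ^ m"
        from n[rule_format, OF m, of \<rho>] \<rho> obtain \<theta> where \<theta>: "\<theta> \<in> X" "\<And>l f :: nat \<Rightarrow> nat. m \<le> l \<Longrightarrow>
            (\<And>j. j < 2 ^ m \<Longrightarrow> f j < 2 ^ l \<and> f j mod 2 ^ m = j) \<Longrightarrow> sat (M l) (b l \<circ> f \<circ> \<rho>) \<theta>"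
          by blast
        have fv: "fv \<theta> \<subseteq> {..<k}"
          using covering_tasks[OF task] \<theta>(1) unfolding covering_def by blast
        have "sat (M l) (\<lambda>i. branch (h i) l) \<theta>"
          if h: "sep k h m" "\<forall>i<k. prefix_code (h i) m = \<rho> i" and "m \<le> l" for h l
        proof -
          \<comment> \<open>Nodes on a chosen branch follow it to level \<open>l\<close>; any other
            node keeps its number, which extends its string by zeros.\<close>
          define f where "f j = (if \<exists>i<k. \<rho> i = j then prefix_code (h (SOME i. i < k \<and> \<rho> i = j)) l else j)" for j
          have f: "f (\<rho> i) = prefix_code (h i) l" if "i < k" for i
          proof -
            define i' where "i' = (SOME i'. i' < k \<and> \<rho> i' = \<rho> i)"
            have i': "i' < k \<and> \<rho> i' = \<rho> i"
              unfolding i'_def by (rule someI[of _ i]) (use that in auto)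
            then have "h i' = h i"
              using h that unfolding sep_def by metis
            then show ?thesis
              using that unfolding f_def i'_def by auto
          qed
          have "f j < 2 ^ l \<and> f j mod 2 ^ m = j" if "j < 2 ^ m" for j
          proof (cases "\<exists>i<k. \<rho> i = j")
            case True
            then obtain i where i: "i < k" "\<rho> i = j" by blast
            then show ?thesis
              using f[OF i(1)] h(2) prefix_code_less prefix_code_mod[OF \<open>m \<le> l\<close>] by auto
          next
            case False
            have "(2 :: nat) ^ m \<le> 2 ^ l"
              using \<open>m \<le> l\<close> by (rule power_increasing) simp
            then have "j < 2 ^ l"
              using that by linarith
            moreover have "f j = j"
              using False unfolding f_def by (rule if_not_P)
            ultimately show ?thesis
              using that by simp
          qed
          then have "sat (M l) (b l \<circ> f \<circ> \<rho>) \<theta>"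
            using \<theta>(2) \<open>m \<le> l\<close> by blast
          also have "sat (M l) (b l \<circ> f \<circ> \<rho>) \<theta> \<longleftrightarrow> sat (M l) (\<lambda>i. branch (h i) l) \<theta>"
            by (rule sat_cong) (use fv f in \<open>auto simp: branch_def\<close>)
          finally show ?thesis .
        qed
        then show "\<exists>\<theta>\<in>X. \<forall>h. sep k h m \<longrightarrow> (\<forall>i<k. prefix_code (h i) m = \<rho> i) \<longrightarrow>
            (\<forall>\<^sub>F l in sequentially. sat (M l) (\<lambda>i. branch (h i) l) \<theta>)"
          using \<theta>(1) unfolding eventually_sequentially by blast
      qed
    qed
    have choose1: "\<exists>\<theta>\<in>X. \<forall>\<^sub>F l in sequentially. sat (M l) (\<lambda>i. branch (h i) l) \<theta>"
      if "(k, X) \<in> tasks" for k X h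
    proof -
      obtain n where n: "\<forall>m\<ge>n. \<forall>\<rho>. (\<forall>j. \<rho> j < 2 ^ m) \<longrightarrow> (\<exists>\<theta>\<in>X. \<forall>h. sep k h m \<longrightarrow>
          (\<forall>i<k. prefix_code (h i) m = \<rho> i) \<longrightarrow> (\<forall>\<^sub>F l in sequentially. sat (M l) (\<lambda>i. branch (h i) l) \<theta>))"
        using choose[OF \<open>(k, X) \<in> tasks\<close>] by blast
      obtain m where "n \<le> m" "sep k h m"
        using ev_sep[of k h] unfolding eventually_sequentially by (metis nle_le)
      then show ?thesis
        using n[rule_format, of m "\<lambda>i. prefix_code (h i) m"] prefix_code_less by blast
    qed
    have fv_bound: "\<exists>k. fv \<theta> \<subseteq> {..<k}" for \<theta> :: "('f, 'r) fm"
      using finite_fv[of \<theta>] finite_nat_iff_bounded by blast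
    have "branching_models L T \<Delta> U M branch"
    proof
      show "models L (M l) T" for l
        using M unfolding model_def by blast
      show "branch \<eta> l \<in> Dom (M l)" for \<eta> l
        using b(1) unfolding branch_def by blast
      show "\<forall>\<^sub>F l in sequentially. branch \<eta> l \<noteq> branch \<tau> l" if "\<eta> \<noteq> \<tau>" for \<eta> \<tau>
        using eventually_prefix_code_neq[OF that]
      proof (rule eventually_mono)
        show "branch \<eta> l \<noteq> branch \<tau> l" if "prefix_code \<eta> l \<noteq> prefix_code \<tau> l" for l
          using that inj_onD[OF b(2)] prefix_code_less unfolding branch_def by blast
      qed
      show "(\<forall>\<^sub>F l in sequentially. sat (M l) (\<lambda>i. branch (h i) l) \<theta>) \<or>
          (\<forall>\<^sub>F l in sequentially. \<not> sat (M l) (\<lambda>i. branch (h i) l) \<theta>)" if "wf_fm L \<theta>" for \<theta> h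
      proof -
        obtain k where "fv \<theta> \<subseteq> {..<k}"
          using fv_bound by blast
        from choose1[OF truth_task[OF that this], of h] show ?thesis
          by simp
      qed
      show "(\<forall>\<^sub>F l in sequentially. sat (M l) (\<lambda>i. branch (h i) l) (Neg (Ex 0 \<psi>))) \<or>
          (\<exists>\<delta>\<in>\<Delta>. \<forall>\<^sub>F l in sequentially. sat (M l) (\<lambda>i. branch (h i) l) (Ex 0 (And \<psi> (Neg \<delta>))))"
        if "wf_fm L \<psi>" for \<psi> h
      proof -
        obtain k where "fv \<psi> \<subseteq> {..<k}"
          using fv_bound by blast
        from choose1[OF omit_task[OF that this], of h] show ?thesis
          unfolding omit_def by blast
      qed
      show "\<exists>n. \<forall>l\<ge>n. \<forall>\<eta>s \<tau>s. length \<eta>s = k \<longrightarrow> similar_mod l \<eta>s \<tau>s \<longrightarrow>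
          ((\<forall>\<^sub>F j in sequentially. sat (M j) (\<lambda>i. branch (\<eta>s ! i) j) \<theta>) \<longleftrightarrow>
           (\<forall>\<^sub>F j in sequentially. sat (M j) (\<lambda>i. branch (\<tau>s ! i) j) \<theta>))"
        if \<theta>: "wf_fm L \<theta>" "fv \<theta> \<subseteq> {..<k}" for \<theta> k
      proof -
        from choose[OF truth_task[OF \<theta>]] obtain n where n: "\<forall>m\<ge>n. \<forall>\<rho>. (\<forall>j. \<rho> j < 2 ^ m) \<longrightarrow>
            (\<exists>\<theta>'\<in>{\<theta>, Neg \<theta>}. \<forall>h. sep k h m \<longrightarrow> (\<forall>i<k. prefix_code (h i) m = \<rho> i) \<longrightarrow>
              (\<forall>\<^sub>F l in sequentially. sat (M l) (\<lambda>i. branch (h i) l) \<theta>'))"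
          by (elim exE)
        show ?thesis
        proof (intro exI[of _ n] allI impI)
          fix l \<eta>s \<tau>s assume l: "n \<le> l" and len: "length \<eta>s = k" and sim: "similar_mod l \<eta>s \<tau>s"
          have prefix_code_\<tau>: "prefix_code (\<tau>s ! i) l = prefix_code (\<eta>s ! i) l" if "i < k" for i
            using sim that len unfolding similar_mod_def prefix_code_eq_iff by simp
          have neq: "prefix_code (\<eta>s ! i) l \<noteq> prefix_code (\<eta>s ! j) l" if "i < k" "j < k" "i \<noteq> j" for i j
            using nth_eq_iff_index_eq[of "map (\<lambda>\<eta>. restr \<eta> l) \<eta>s" i j] sim that len
            unfolding similar_mod_def prefix_code_eq_iff by simp
          \<comment> \<open>Both tuples pass through the same distinct nodes at level
            \<open>l\<close>, so one \<theta>' serves both.\<close>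
          have sep: "sep k ((!) \<eta>s) l" "sep k ((!) \<tau>s) l"
            unfolding sep_def using neq prefix_code_\<tau> by metis+
          from n[rule_format, OF l, of "\<lambda>j. prefix_code (\<eta>s ! j) l"] prefix_code_less
          obtain \<theta>' where \<theta>': "\<theta>' = \<theta> \<or> \<theta>' = Neg \<theta>"
              "\<And>h. sep k h l \<Longrightarrow> (\<forall>i<k. prefix_code (h i) l = prefix_code (\<eta>s ! i) l) \<Longrightarrow>
                (\<forall>\<^sub>F j in sequentially. sat (M j) (\<lambda>i. branch (h i) j) \<theta>')"
            by blast
          have ev: "\<forall>\<^sub>F j in sequentially. sat (M j) (\<lambda>i. branch (\<eta>s ! i) j) \<theta>'"
            "\<forall>\<^sub>F j in sequentially. sat (M j) (\<lambda>i. branch (\<tau>s ! i) j) \<theta>'"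
            using \<theta>'(2)[OF sep(1)] \<theta>'(2)[OF sep(2)] prefix_code_\<tau> by blast+
          have not_both: "\<not> (\<forall>\<^sub>F j in sequentially. P j)"
            if "\<forall>\<^sub>F j in sequentially. \<not> P j" for P :: "nat \<Rightarrow> bool"
            using eventually_conj[OF that, of P] by auto
          show "(\<forall>\<^sub>F j in sequentially. sat (M j) (\<lambda>i. branch (\<eta>s ! i) j) \<theta>) \<longleftrightarrow>
              (\<forall>\<^sub>F j in sequentially. sat (M j) (\<lambda>i. branch (\<tau>s ! i) j) \<theta>)"
            using \<theta>'(1) ev not_both by auto
        qed
      qed
    qed (fact cnt th ty sk univ)+
    then show thesis
      by (rule that)
  qed
qed

end

theorem theorem7p2p5:
  fixes L\<^sub>\<Phi> L :: "('f, 'r) lang"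
    and \<Phi> :: "('f, 'r) infm"
    and T' \<Delta> :: "('f, 'r) fm set"
  assumes universe: "(UNIV :: (nat \<Rightarrow> bool) set) \<lesssim> (UNIV :: 'u set)"
    and "countable_lang L\<^sub>\<Phi>"
    and "is_sentence L\<^sub>\<Phi> \<Phi>"
    and "Skolemized_representation TYPE('u) L\<^sub>\<Phi> \<Phi> L T' \<Delta>"
    and "\<And>\<alpha> :: 'u ordinal. countable {..<\<alpha>} \<Longrightarrow>
           \<exists>M :: ('f, 'r, 'u) struct. models L M T' \<and> omits M \<Delta> \<and> sprk L M \<ge> Fin \<alpha>"
  shows "\<exists>N :: ('f, 'r, 'u) struct.
           models L N T' \<and> omits N \<Delta> \<and> Dom N \<approx> (UNIV :: (nat \<Rightarrow> bool) set) \<and>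
           (\<exists>c. asymptotically_similar L N c)"
proof -
  have rep: "countable_lang L" "is_theory L T'" "is_partial_1type L \<Delta>"
    "has_definable_Skolem_functions TYPE('u) L T'" "has_quantifier_elimination TYPE('u) L T'"
    using assms(4) unfolding Skolemized_representation_def representation_def by auto
  \<comment> \<open>A diagonal argument. Uncountability of \<open>'u\<close> passes to
    \<open>'u ordinal\<close>, on which the bounds for countable sets of countable ordinals
    rest.\<close>
  have "uncountable (UNIV :: (nat \<Rightarrow> bool) set)"
  proof
    assume "countable (UNIV :: (nat \<Rightarrow> bool) set)"
    then obtain f :: "nat \<Rightarrow> nat \<Rightarrow> bool" where "range f = UNIV"
      using uncountable_def[of "UNIV :: (nat \<Rightarrow> bool) set"] by auto
    then obtain n where "f n = (\<lambda>i. \<not> f i i)"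
      by (metis UNIV_I imageE)
    then show False
      by (metis (full_types))
  qed
  then have "uncountable (UNIV :: 'u set)"
    using universe countable_lepoll by blast
  then interpret high_rank_models L T' \<Delta> "TYPE('u)"
    by unfold_locales (use rep assms(5) in auto)
  obtain M branch where "branching_models L T' \<Delta> TYPE('u) M branch"
    using ex_branching_models[OF rep(1-4) universe] .
  then interpret branching_models L T' \<Delta> "TYPE('u)" M branch .
  obtain e :: "(nat \<Rightarrow> 'u) \<Rightarrow> 'u" where "range e \<lesssim> (UNIV :: (nat \<Rightarrow> bool) set)"
    "\<And>g g'. definable g \<Longrightarrow> definable g' \<Longrightarrow> e g = e g' \<longleftrightarrow> (\<forall>\<^sub>F l in sequentially. g l = g' l)"
    using ex_quotient_map by blast
  then interpret limit_structure L T' \<Delta> "TYPE('u)" M branch e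
    by unfold_locales
  show ?thesis
    using models_N omits_N Dom_N_eqpoll asymptotically_similar_c by blast
qed

end
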